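(* Let $F$ be a field, let $P$ and $U$ be two given Poisson algebras over $F$ with $U$ finite dimensional, let $(\mathcal{B}(P,U),\psi_{\mathcal{B}(P,U)})$ be the corresponding universal coacting Poisson algebra, and let $f\colon U\to P$ be a Poisson algebra homomorphism. Then: (1) There exists a coassociative Poisson algebra homomorphism $\Delta_f\colon \mathcal{B}(P,U)\to \mathcal{B}(P,U)\otimes \mathcal{B}(P,U)$. (2) If $g\colon P\to U$ is another Poisson algebra homomorphism such that $$\psi_{\mathcal{B}(P,U)}=\psi_{\mathcal{B}(P,U)}\circ(f\circ g)\qquad\text{and}\qquad \psi_{\mathcal{B}(P,U)}=\bigl((g\circ f)\otimes\mathrm{id}_{\mathcal{B}(P,U)}\bigr)\circ\psi_{\mathcal{B}(P,U)},$$ then there exists a Poisson algebra homomorphism $\varepsilon_g\colon \mathcal{B}(P,U)\to F$ such that $(\mathcal{B}(P,U),\Delta_f,\varepsilon_g)$ becomes a Poisson bialgebra.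
   Context: All vector spaces, algebras, coalgebras and tensor products are over the field $F$; algebras are associative and unital and coalgebras are coassociative and counital. A Poisson algebra is a vector space $P$ carrying both a commutative associative unital algebra structure and a Lie algebra structure $[\cdot,\cdot]$ such that $[p,qr]=[p,q]\,r+q\,[p,r]$ for all $p,q,r\in P$. A morphism of Poisson algebras is a linear map that is both a (unital) algebra homomorphism and a Lie algebra homomorphism. The field $F$ is a Poisson algebra with zero bracket. If $P_1,P_2$ are Poisson algebras, $P_1\otimes P_2$ is a Poisson algebra with $(p\otimes q)(r\otimes s)=pr\otimes qs$ and $[p\otimes q,r\otimes s]=pr\otimes[q,s]_{P_2}+[p,r]_{P_1}\otimes qs$. A map $\Delta\colon B\to B\otimes B$ is coassociative if $(\Delta\otimes\mathrm{id}_B)\circ\Delta=(\mathrm{id}_B\otimes\Delta)\circ\Delta$. A Poisson bialgebra is a commutative bialgebra with a Poisson bracket (making its underlying algebra a Poisson algebra) such that the comultiplication and the counit are Poisson algebra homomorphisms. For Poisson algebras $P$ and $U$ with $U$ finite dimensional, the universal (coacting) Poisson algebra of $P$ and $U$ (which exists) is a Poisson algebra $\mathcal{B}(P,U)$ together with a Poisson algebra homomorphism $\psi_{\mathcal{B}(P,U)}\colon P\to U\otimes\mathcal{B}(P,U)$ such that for every Poisson algebra $Q$ and every Poisson algebra homomorphism $h\colon P\to U\otimes Q$ there is a unique Poisson algebra homomorphism $k\colon\mathcal{B}(P,U)\to Q$ with $(\mathrm{id}_U\otimes k)\circ\psi_{\mathcal{B}(P,U)}=h$. *)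

theory Defs
  imports "HOL-Algebra.Module" "HOL-Library.Multiset"
begin

section \<open>Tensor products over a field\<close>

text \<open>
  Elements of the tensor product are formal finite sums \<open>m\<^sub>1 \<otimes> n\<^sub>1 + \<dots> + m\<^sub>k \<otimes> n\<^sub>k\<close>, encoded as the
  lists \<open>[(m\<^sub>1, n\<^sub>1), \<dots>, (m\<^sub>k, n\<^sub>k)]\<close>, modulo the least congruence that makes addition commutative
  and \<open>\<otimes>\<close> bilinear and balanced over \<open>F\<close>.  The universal property is proved below
  (\<open>tensor_universal\<close>).
\<close>

inductive_set tensor_rel ::
  "('f, 'k) ring_scheme \<Rightarrow> ('f, 'm, 'x) module_scheme \<Rightarrow> ('f, 'n, 'y) module_scheme
    \<Rightarrow> (('m \<times> 'n) list \<times> ('m \<times> 'n) list) set"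
  for F M N where
  perm: "\<lbrakk>xs \<in> lists (carrier M \<times> carrier N); mset xs = mset ys\<rbrakk> \<Longrightarrow> (xs, ys) \<in> tensor_rel F M N"
| sym: "(xs, ys) \<in> tensor_rel F M N \<Longrightarrow> (ys, xs) \<in> tensor_rel F M N"
| trans: "\<lbrakk>(xs, ys) \<in> tensor_rel F M N; (ys, zs) \<in> tensor_rel F M N\<rbrakk> \<Longrightarrow> (xs, zs) \<in> tensor_rel F M N"
| Cons: "\<lbrakk>(xs, ys) \<in> tensor_rel F M N; z \<in> carrier M \<times> carrier N\<rbrakk>
    \<Longrightarrow> (z # xs, z # ys) \<in> tensor_rel F M N"
| zero: "n \<in> carrier N \<Longrightarrow> ([(\<zero>\<^bsub>M\<^esub>, n)], []) \<in> tensor_rel F M N"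
| add_left: "\<lbrakk>m \<in> carrier M; m' \<in> carrier M; n \<in> carrier N\<rbrakk>
    \<Longrightarrow> ([(m \<oplus>\<^bsub>M\<^esub> m', n)], [(m, n), (m', n)]) \<in> tensor_rel F M N"
| add_right: "\<lbrakk>m \<in> carrier M; n \<in> carrier N; n' \<in> carrier N\<rbrakk>
    \<Longrightarrow> ([(m, n \<oplus>\<^bsub>N\<^esub> n')], [(m, n), (m, n')]) \<in> tensor_rel F M N"
| balanced: "\<lbrakk>c \<in> carrier F; m \<in> carrier M; n \<in> carrier N\<rbrakk>
    \<Longrightarrow> ([(c \<odot>\<^bsub>M\<^esub> m, n)], [(m, c \<odot>\<^bsub>N\<^esub> n)]) \<in> tensor_rel F M N"

definition tensor_class ::
  "('f, 'k) ring_scheme \<Rightarrow> ('f, 'm, 'x) module_scheme \<Rightarrow> ('f, 'n, 'y) module_scheme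
    \<Rightarrow> ('m \<times> 'n) list \<Rightarrow> ('m \<times> 'n) list set"
  where "tensor_class F M N xs = tensor_rel F M N `` {xs}"

definition pure_tensor ::
  "('f, 'k) ring_scheme \<Rightarrow> ('f, 'm, 'x) module_scheme \<Rightarrow> ('f, 'n, 'y) module_scheme
    \<Rightarrow> 'm \<Rightarrow> 'n \<Rightarrow> ('m \<times> 'n) list set"
  where "pure_tensor F M N m n = tensor_class F M N [(m, n)]"

text \<open>The ring-multiplicative fields play no role in the locale \<^locale>\<open>module\<close> and are left undefined.\<close>

definition tensor_space ::
  "('f, 'k) ring_scheme \<Rightarrow> ('f, 'm, 'x) module_scheme \<Rightarrow> ('f, 'n, 'y) module_scheme
    \<Rightarrow> ('f, ('m \<times> 'n) list set) module"
  where "tensor_space F M N =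
    \<lparr>carrier = lists (carrier M \<times> carrier N) // tensor_rel F M N,
     monoid.mult = undefined, one = undefined,
     zero = tensor_class F M N [],
     add = (\<lambda>A B. \<Union>xs\<in>A. \<Union>ys\<in>B. tensor_class F M N (xs @ ys)),
     smult = (\<lambda>c A. \<Union>xs\<in>A. tensor_class F M N (map (\<lambda>(m, n). (c \<odot>\<^bsub>M\<^esub> m, n)) xs))\<rparr>"

text \<open>
  The linear map on \<open>M \<otimes> N\<close> induced by a bilinear map \<open>\<beta>\<close> with values in \<open>W\<close>.  The value does not
  depend on the chosen representative when \<open>\<beta>\<close> is bilinear.
\<close>

definition tensor_sum :: "('w, 'z) ring_scheme \<Rightarrow> ('m \<Rightarrow> 'n \<Rightarrow> 'w) \<Rightarrow> ('m \<times> 'n) list \<Rightarrow> 'w"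
  where "tensor_sum W \<beta> xs = foldr (\<lambda>(m, n) w. \<beta> m n \<oplus>\<^bsub>W\<^esub> w) xs \<zero>\<^bsub>W\<^esub>"

definition tensor_lift :: "('w, 'z) ring_scheme \<Rightarrow> ('m \<Rightarrow> 'n \<Rightarrow> 'w) \<Rightarrow> ('m \<times> 'n) list set \<Rightarrow> 'w"
  where "tensor_lift W \<beta> A = tensor_sum W \<beta> (SOME xs. xs \<in> A)"

text \<open>\<open>tensor_map F M' N' f g\<close> is \<open>f \<otimes> g\<close>, where \<open>M'\<close> and \<open>N'\<close> are the codomains of \<open>f\<close> and \<open>g\<close>.\<close>

definition tensor_map ::
  "('f, 'k) ring_scheme \<Rightarrow> ('f, 'm1, 'x) module_scheme \<Rightarrow> ('f, 'n1, 'y) module_scheme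
    \<Rightarrow> ('m \<Rightarrow> 'm1) \<Rightarrow> ('n \<Rightarrow> 'n1) \<Rightarrow> ('m \<times> 'n) list set \<Rightarrow> ('m1 \<times> 'n1) list set"
  where "tensor_map F M' N' f g =
    tensor_lift (tensor_space F M' N') (\<lambda>m n. pure_tensor F M' N' (f m) (g n))"

text \<open>The associator \<open>(M \<otimes> N) \<otimes> L \<rightarrow> M \<otimes> (N \<otimes> L)\<close>.\<close>

definition tensor_assoc ::
  "('f, 'k) ring_scheme \<Rightarrow> ('f, 'm, 'x) module_scheme \<Rightarrow> ('f, 'n, 'y) module_scheme
    \<Rightarrow> ('f, 'l, 'z) module_scheme
    \<Rightarrow> (('m \<times> 'n) list set \<times> 'l) list set \<Rightarrow> ('m \<times> ('n \<times> 'l) list set) list set"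
  where "tensor_assoc F M N L =
    (let T = tensor_space F M (tensor_space F N L)
     in tensor_lift T (\<lambda>t l. tensor_lift T
          (\<lambda>m n. pure_tensor F M (tensor_space F N L) m (pure_tensor F N L n l)) t))"

definition finite_dimensional ::
  "('f, 'k) ring_scheme \<Rightarrow> ('f, 'm, 'x) module_scheme \<Rightarrow> bool"
  where "finite_dimensional F M \<longleftrightarrow>
    (\<exists>S. finite S \<and> S \<subseteq> carrier M \<and>
       (\<forall>x\<in>carrier M. \<exists>a\<in>S \<rightarrow> carrier F. x = (\<Oplus>\<^bsub>M\<^esub>s\<in>S. a s \<odot>\<^bsub>M\<^esub> s)))"


subsection \<open>The tensor product is a module with the universal property\<close>

definition bilinear_on ::
  "('f, 'k) ring_scheme \<Rightarrow> ('f, 'm, 'x) module_scheme \<Rightarrow> ('f, 'n, 'y) module_scheme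
    \<Rightarrow> ('f, 'w, 'z) module_scheme \<Rightarrow> ('m \<Rightarrow> 'n \<Rightarrow> 'w) \<Rightarrow> bool" where
  "bilinear_on F M N W \<beta> \<longleftrightarrow>
    (\<forall>m\<in>carrier M. \<forall>n\<in>carrier N. \<beta> m n \<in> carrier W) \<and>
    (\<forall>m\<in>carrier M. \<forall>m'\<in>carrier M. \<forall>n\<in>carrier N. \<beta> (m \<oplus>\<^bsub>M\<^esub> m') n = \<beta> m n \<oplus>\<^bsub>W\<^esub> \<beta> m' n) \<and>
    (\<forall>m\<in>carrier M. \<forall>n\<in>carrier N. \<forall>n'\<in>carrier N. \<beta> m (n \<oplus>\<^bsub>N\<^esub> n') = \<beta> m n \<oplus>\<^bsub>W\<^esub> \<beta> m n') \<and>
    (\<forall>c\<in>carrier F. \<forall>m\<in>carrier M. \<forall>n\<in>carrier N.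
       \<beta> (c \<odot>\<^bsub>M\<^esub> m) n = c \<odot>\<^bsub>W\<^esub> \<beta> m n \<and> \<beta> m (c \<odot>\<^bsub>N\<^esub> n) = c \<odot>\<^bsub>W\<^esub> \<beta> m n)"

definition linear_on ::
  "('f, 'k) ring_scheme \<Rightarrow> ('f, 'm, 'x) module_scheme \<Rightarrow> ('f, 'w, 'z) module_scheme
    \<Rightarrow> ('m \<Rightarrow> 'w) \<Rightarrow> bool" where
  "linear_on F M W h \<longleftrightarrow> h \<in> carrier M \<rightarrow> carrier W \<and>
    (\<forall>x\<in>carrier M. \<forall>y\<in>carrier M. h (x \<oplus>\<^bsub>M\<^esub> y) = h x \<oplus>\<^bsub>W\<^esub> h y) \<and>
    (\<forall>c\<in>carrier F. \<forall>x\<in>carrier M. h (c \<odot>\<^bsub>M\<^esub> x) = c \<odot>\<^bsub>W\<^esub> h x)"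

context
  notes in_lists_conv_set [simp del] and in_listsI [rule del] and in_listsD [rule del]
begin

lemma tensor_rel_carrier:
  assumes "module F M" "module F N" "(xs, ys) \<in> tensor_rel F M N"
  shows "xs \<in> lists (carrier M \<times> carrier N) \<and> ys \<in> lists (carrier M \<times> carrier N)"
proof -
  interpret M: module F M by fact
  interpret N: module F N by fact
  show ?thesis using assms(3)
  proof induction
    case (perm xs ys)
    then show ?case using mset_eq_setD[of xs ys] by (auto simp: in_lists_conv_set)
  qed auto
qed

lemma tensor_rel_equiv:
  assumes "module F M" "module F N"
  shows "equiv (lists (carrier M \<times> carrier N)) (tensor_rel F M N)"
proof (rule equivI)
  show "tensor_rel F M N \<subseteq> lists (carrier M \<times> carrier N) \<times> lists (carrier M \<times> carrier N)"
    using tensor_rel_carrier[OF assms] by auto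
  show "refl_on (lists (carrier M \<times> carrier N)) (tensor_rel F M N)"
    by (rule refl_onI) (blast intro: tensor_rel.perm)
  show "sym (tensor_rel F M N)" by (rule symI) (rule tensor_rel.sym)
  show "trans (tensor_rel F M N)" by (rule transI) (rule tensor_rel.trans)
qed

lemma tensor_rel_append:
  assumes M: "module F M" and N: "module F N"
    and "(xs, xs') \<in> tensor_rel F M N" "(ys, ys') \<in> tensor_rel F M N"
  shows "(xs @ ys, xs' @ ys') \<in> tensor_rel F M N"
proof -
  have *: "(zs @ as, zs @ bs) \<in> tensor_rel F M N"
    if "(as, bs) \<in> tensor_rel F M N" "zs \<in> lists (carrier M \<times> carrier N)" for zs as bs
    using that(2,1) by (induction zs) (auto intro: tensor_rel.Cons)
  note c = tensor_rel_carrier[OF M N assms(3)] tensor_rel_carrier[OF M N assms(4)]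
  have "(xs @ ys, ys @ xs) \<in> tensor_rel F M N" "(ys @ xs', xs' @ ys) \<in> tensor_rel F M N"
    using c by (auto intro!: tensor_rel.perm)
  then show ?thesis
    using *[OF assms(3), of ys] *[OF assms(4), of xs'] c by (blast intro: tensor_rel.trans)
qed

lemma tensor_rel_smult:
  assumes M: "module F M" and N: "module F N" and c: "c \<in> carrier F"
    and "(xs, ys) \<in> tensor_rel F M N"
  shows "(map (\<lambda>(m, n). (c \<odot>\<^bsub>M\<^esub> m, n)) xs, map (\<lambda>(m, n). (c \<odot>\<^bsub>M\<^esub> m, n)) ys) \<in> tensor_rel F M N"
proof -
  interpret M: module F M by fact
  interpret N: module F N by fact
  show ?thesis using assms(4)
  proof induction
    case (perm xs ys)
    then show ?case using c by (intro tensor_rel.perm) (auto simp: in_lists_conv_set)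
  next
    case (balanced d m n)
    have "([(d \<odot>\<^bsub>M\<^esub> (c \<odot>\<^bsub>M\<^esub> m), n)], [(c \<odot>\<^bsub>M\<^esub> m, d \<odot>\<^bsub>N\<^esub> n)]) \<in> tensor_rel F M N"
      using balanced c by (intro tensor_rel.balanced) auto
    moreover have "d \<odot>\<^bsub>M\<^esub> (c \<odot>\<^bsub>M\<^esub> m) = c \<odot>\<^bsub>M\<^esub> (d \<odot>\<^bsub>M\<^esub> m)"
      using balanced c by (metis M.smult_assoc1 M.R.m_comm)
    ultimately show ?case by simp
  qed (use c in \<open>auto intro: tensor_rel.intros simp: M.smult_r_distr\<close>)
qed

lemma tensor_class_eq_iff:
  assumes "module F M" "module F N"
    "xs \<in> lists (carrier M \<times> carrier N)" "ys \<in> lists (carrier M \<times> carrier N)"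
  shows "tensor_class F M N xs = tensor_class F M N ys \<longleftrightarrow> (xs, ys) \<in> tensor_rel F M N"
  unfolding tensor_class_def using eq_equiv_class_iff[OF tensor_rel_equiv] assms by metis

lemma tensor_carrier_cases:
  assumes "A \<in> carrier (tensor_space F M N)"
  obtains xs where "xs \<in> lists (carrier M \<times> carrier N)" "A = tensor_class F M N xs"
  using assms unfolding tensor_space_def tensor_class_def by (auto elim!: quotientE)

lemma tensor_class_closed:
  "xs \<in> lists (carrier M \<times> carrier N) \<Longrightarrow> tensor_class F M N xs \<in> carrier (tensor_space F M N)"
  unfolding tensor_space_def tensor_class_def by (auto intro: quotientI)

lemma tensor_space_zero: "\<zero>\<^bsub>tensor_space F M N\<^esub> = tensor_class F M N []"
  by (simp add: tensor_space_def)

lemma tensor_space_add: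
  assumes M: "module F M" and N: "module F N"
    and xs: "xs \<in> lists (carrier M \<times> carrier N)" and ys: "ys \<in> lists (carrier M \<times> carrier N)"
  shows "tensor_class F M N xs \<oplus>\<^bsub>tensor_space F M N\<^esub> tensor_class F M N ys
    = tensor_class F M N (xs @ ys)"
proof -
  let ?R = "tensor_rel F M N"
  have ne: "xs \<in> ?R `` {xs}" "ys \<in> ?R `` {ys}"
    using xs ys by (auto intro: tensor_rel.perm)
  have "tensor_class F M N (xs' @ ys') = tensor_class F M N (xs @ ys)"
    if "xs' \<in> ?R `` {xs}" "ys' \<in> ?R `` {ys}" for xs' ys'
  proof -
    have "(xs @ ys, xs' @ ys') \<in> ?R" using tensor_rel_append[OF M N] that by auto
    then show ?thesis using tensor_rel_carrier[OF M N]
      by (metis tensor_class_eq_iff[OF M N])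
  qed
  then have "(\<Union>xs\<in>?R `` {xs}. \<Union>ys\<in>?R `` {ys}. tensor_class F M N (xs @ ys))
     = (\<Union>xs'\<in>?R `` {xs}. \<Union>ys'\<in>?R `` {ys}. tensor_class F M N (xs @ ys))"
    by (intro SUP_cong refl) auto
  then show ?thesis using ne unfolding tensor_space_def by (auto simp: tensor_class_def)
qed

lemma tensor_space_smult:
  assumes M: "module F M" and N: "module F N" and c: "c \<in> carrier F"
    and xs: "xs \<in> lists (carrier M \<times> carrier N)"
  shows "c \<odot>\<^bsub>tensor_space F M N\<^esub> tensor_class F M N xs
    = tensor_class F M N (map (\<lambda>(m, n). (c \<odot>\<^bsub>M\<^esub> m, n)) xs)"
proof -
  let ?R = "tensor_rel F M N" and ?f = "map (\<lambda>(m, n). (c \<odot>\<^bsub>M\<^esub> m, n))"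
  have ne: "xs \<in> ?R `` {xs}"
    using xs by (auto intro: tensor_rel.perm)
  have "tensor_class F M N (?f xs') = tensor_class F M N (?f xs)" if "xs' \<in> ?R `` {xs}" for xs'
  proof -
    have "(?f xs, ?f xs') \<in> ?R" using tensor_rel_smult[OF M N c] that by auto
    then show ?thesis using tensor_rel_carrier[OF M N]
      by (metis tensor_class_eq_iff[OF M N])
  qed
  then have "(\<Union>xs\<in>?R `` {xs}. tensor_class F M N (?f xs))
     = (\<Union>xs'\<in>?R `` {xs}. tensor_class F M N (?f xs))"
    by (intro SUP_cong refl) auto
  then show ?thesis using ne unfolding tensor_space_def by (auto simp: tensor_class_def)
qed

lemma tensor_smult_list:
  assumes "module F M" "c \<in> carrier F" "xs \<in> lists (carrier M \<times> carrier N)"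
  shows "map (\<lambda>(m, n). (c \<odot>\<^bsub>M\<^esub> m, n)) xs \<in> lists (carrier M \<times> carrier N)"
proof -
  interpret M: module F M by fact
  show ?thesis using assms(2,3) by (auto simp: in_lists_conv_set)
qed

lemma tensor_space_module:
  assumes M: "module F M" and N: "module F N"
  shows "module F (tensor_space F M N)"
proof -
  interpret M: module F M by fact
  interpret N: module F N by fact
  let ?L = "lists (carrier M \<times> carrier N)" and ?T = "tensor_space F M N"
    and ?R = "tensor_rel F M N" and ?c = "tensor_class F M N"
  note add = tensor_space_add[OF M N] and smult = tensor_space_smult[OF M N]
    and sl = tensor_smult_list[OF M] and cl = tensor_class_closed
    and eq = tensor_class_eq_iff[OF M N]
  have app: "xs @ ys \<in> ?L" if "xs \<in> ?L" "ys \<in> ?L" for xs ys using that by auto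
  have perm: "?c xs = ?c ys" if "xs \<in> ?L" "mset xs = mset ys" for xs ys
  proof -
    have "(xs, ys) \<in> ?R" using that by (rule tensor_rel.perm)
    then show ?thesis using eq tensor_rel_carrier[OF M N] by blast
  qed
  have ind: "?c (map f xs) = ?c (map g xs @ map h xs)"
    if "xs \<in> ?L" "\<And>z. z \<in> carrier M \<times> carrier N \<Longrightarrow> ([f z], [g z, h z]) \<in> ?R" for f g h xs
  proof -
    have "(map f xs, map g xs @ map h xs) \<in> ?R" using that(1)
    proof (induction xs)
      case Nil show ?case by (simp add: tensor_rel.perm)
    next
      case (Cons z xs)
      have 1: "(map f (z # xs), [g z, h z] @ map g xs @ map h xs) \<in> ?R"
        using tensor_rel_append[OF M N that(2)[OF Cons.hyps(1)] Cons.IH] by simp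
      have "([g z, h z] @ map g xs @ map h xs, map g (z # xs) @ map h (z # xs)) \<in> ?R"
        using tensor_rel_carrier[OF M N 1] by (intro tensor_rel.perm) auto
      with 1 show ?case by (rule tensor_rel.trans)
    qed
    then show ?thesis using eq tensor_rel_carrier[OF M N] by blast
  qed
  have null: "?c (map (\<lambda>(m, n). (\<zero>\<^bsub>M\<^esub>, n)) xs) = ?c []" if "xs \<in> ?L" for xs
  proof -
    have "(map (\<lambda>(m, n). (\<zero>\<^bsub>M\<^esub>, n)) xs, []) \<in> ?R" using that
    proof (induction xs)
      case Nil show ?case by (simp add: tensor_rel.perm)
    next
      case (Cons z xs)
      obtain m n where z: "z = (m, n)" by force
      show ?case
        using tensor_rel_append[OF M N tensor_rel.zero Cons.IH, of n] Cons.hyps z by simp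
    qed
    then show ?thesis using eq tensor_rel_carrier[OF M N] by blast
  qed
  have distr: "(a \<oplus>\<^bsub>F\<^esub> b) \<odot>\<^bsub>?T\<^esub> ?c xs = (a \<odot>\<^bsub>?T\<^esub> ?c xs) \<oplus>\<^bsub>?T\<^esub> (b \<odot>\<^bsub>?T\<^esub> ?c xs)"
    if "a \<in> carrier F" "b \<in> carrier F" "xs \<in> ?L" for a b xs
    unfolding smult[OF that(1,3)] smult[OF that(2,3)] smult[OF M.R.a_closed[OF that(1,2)] that(3)]
      add[OF sl[OF that(1,3)] sl[OF that(2,3)]]
    by (rule ind[OF that(3)])
      (use that in \<open>auto intro!: tensor_rel.add_left simp: M.smult_l_distr\<close>)
  have null': "\<zero>\<^bsub>F\<^esub> \<odot>\<^bsub>?T\<^esub> ?c xs = ?c []" if "xs \<in> ?L" for xs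
  proof -
    have "map (\<lambda>(m, n). (\<zero>\<^bsub>F\<^esub> \<odot>\<^bsub>M\<^esub> m, n)) xs = map (\<lambda>(m, n). (\<zero>\<^bsub>M\<^esub>, n)) xs"
      using that by (auto simp: in_lists_conv_set)
    then show ?thesis using smult[OF M.R.zero_closed that] null[OF that] by (simp only:)
  qed
  have one': "\<one>\<^bsub>F\<^esub> \<odot>\<^bsub>?T\<^esub> ?c xs = ?c xs" if "xs \<in> ?L" for xs
  proof -
    have "map (\<lambda>(m, n). (\<one>\<^bsub>F\<^esub> \<odot>\<^bsub>M\<^esub> m, n)) xs = xs"
      using that by (auto intro!: map_idI simp: in_lists_conv_set)
    then show ?thesis using smult[OF M.R.one_closed that] by simp
  qed
  show ?thesis
  proof (rule moduleI)
    show "cring F" by (rule M.R.is_cring)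
    show "abelian_group ?T"
    proof (rule abelian_groupI)
      fix A assume A: "A \<in> carrier ?T"
      then obtain xs where xs: "xs \<in> ?L" "A = ?c xs" by (rule tensor_carrier_cases)
      show "\<exists>B\<in>carrier ?T. B \<oplus>\<^bsub>?T\<^esub> A = \<zero>\<^bsub>?T\<^esub>"
      proof (rule bexI)
        have m1: "\<ominus>\<^bsub>F\<^esub> \<one>\<^bsub>F\<^esub> \<in> carrier F" by simp
        show "(\<ominus>\<^bsub>F\<^esub> \<one>\<^bsub>F\<^esub>) \<odot>\<^bsub>?T\<^esub> A \<in> carrier ?T"
          unfolding xs(2) smult[OF m1 xs(1)] by (rule cl[OF sl[OF m1 xs(1)]])
        have "(\<ominus>\<^bsub>F\<^esub> \<one>\<^bsub>F\<^esub>) \<odot>\<^bsub>?T\<^esub> ?c xs \<oplus>\<^bsub>?T\<^esub> \<one>\<^bsub>F\<^esub> \<odot>\<^bsub>?T\<^esub> ?c xs = \<zero>\<^bsub>?T\<^esub>"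
          using distr[OF m1 M.R.one_closed xs(1)] null'[OF xs(1)]
          by (simp add: M.R.l_neg tensor_space_zero)
        then show "(\<ominus>\<^bsub>F\<^esub> \<one>\<^bsub>F\<^esub>) \<odot>\<^bsub>?T\<^esub> A \<oplus>\<^bsub>?T\<^esub> A = \<zero>\<^bsub>?T\<^esub>"
          using xs one' by simp
      qed
    next
      fix A B assume "A \<in> carrier ?T" "B \<in> carrier ?T"
      then obtain xs ys where "xs \<in> ?L" "A = ?c xs" "ys \<in> ?L" "B = ?c ys"
        by (metis tensor_carrier_cases)
      moreover from this have "?c (xs @ ys) = ?c (ys @ xs)" by (intro perm) auto
      ultimately show "A \<oplus>\<^bsub>?T\<^esub> B = B \<oplus>\<^bsub>?T\<^esub> A" by (simp add: add)
    qed (auto elim!: tensor_carrier_cases simp: add tensor_space_zero app intro!: cl)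
  next
    fix a b A assume ab: "a \<in> carrier F" "b \<in> carrier F" and "A \<in> carrier ?T"
    then obtain xs where xs: "xs \<in> ?L" "A = ?c xs" by (metis tensor_carrier_cases)
    have "map (\<lambda>(m, n). (a \<odot>\<^bsub>M\<^esub> m, n)) (map (\<lambda>(m, n). (b \<odot>\<^bsub>M\<^esub> m, n)) xs)
       = map (\<lambda>(m, n). ((a \<otimes>\<^bsub>F\<^esub> b) \<odot>\<^bsub>M\<^esub> m, n)) xs"
      using xs ab by (auto simp: in_lists_conv_set M.smult_assoc1)
    then show "(a \<otimes>\<^bsub>F\<^esub> b) \<odot>\<^bsub>?T\<^esub> A = a \<odot>\<^bsub>?T\<^esub> (b \<odot>\<^bsub>?T\<^esub> A)"
      using ab xs by (simp add: smult sl del: map_map)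
  next
    fix a b A assume "a \<in> carrier F" "b \<in> carrier F" "A \<in> carrier ?T"
    then show "(a \<oplus>\<^bsub>F\<^esub> b) \<odot>\<^bsub>?T\<^esub> A = a \<odot>\<^bsub>?T\<^esub> A \<oplus>\<^bsub>?T\<^esub> b \<odot>\<^bsub>?T\<^esub> A"
      using distr by (metis tensor_carrier_cases)
  next
    fix A assume "A \<in> carrier ?T"
    then show "\<one>\<^bsub>F\<^esub> \<odot>\<^bsub>?T\<^esub> A = A"
      using one' by (metis tensor_carrier_cases)
  qed (auto elim!: tensor_carrier_cases simp: add smult sl app intro!: cl)
qed

lemma tensor_sum_simps [simp]:
  "tensor_sum W \<beta> [] = \<zero>\<^bsub>W\<^esub>"
  "tensor_sum W \<beta> ((m, n) # xs) = \<beta> m n \<oplus>\<^bsub>W\<^esub> tensor_sum W \<beta> xs"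
  by (simp_all add: tensor_sum_def)

context
  fixes F :: "('f, 'k) ring_scheme" and M :: "('f, 'm, 'x) module_scheme"
    and N :: "('f, 'n, 'y) module_scheme" and W :: "('f, 'w, 'z) module_scheme" and \<beta>
  assumes M: "module F M" and N: "module F N" and W: "module F W"
    and \<beta>: "bilinear_on F M N W \<beta>"
begin

interpretation M: module F M by (rule M)
interpretation N: module F N by (rule N)
interpretation W: module F W by (rule W)

lemma bilinear_onD:
  "m \<in> carrier M \<Longrightarrow> n \<in> carrier N \<Longrightarrow> \<beta> m n \<in> carrier W"
  "m \<in> carrier M \<Longrightarrow> m' \<in> carrier M \<Longrightarrow> n \<in> carrier N \<Longrightarrow> \<beta> (m \<oplus>\<^bsub>M\<^esub> m') n = \<beta> m n \<oplus>\<^bsub>W\<^esub> \<beta> m' n"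
  "m \<in> carrier M \<Longrightarrow> n \<in> carrier N \<Longrightarrow> n' \<in> carrier N \<Longrightarrow> \<beta> m (n \<oplus>\<^bsub>N\<^esub> n') = \<beta> m n \<oplus>\<^bsub>W\<^esub> \<beta> m n'"
  "c \<in> carrier F \<Longrightarrow> m \<in> carrier M \<Longrightarrow> n \<in> carrier N \<Longrightarrow> \<beta> (c \<odot>\<^bsub>M\<^esub> m) n = c \<odot>\<^bsub>W\<^esub> \<beta> m n"
  "c \<in> carrier F \<Longrightarrow> m \<in> carrier M \<Longrightarrow> n \<in> carrier N \<Longrightarrow> \<beta> m (c \<odot>\<^bsub>N\<^esub> n) = c \<odot>\<^bsub>W\<^esub> \<beta> m n"
  using \<beta> unfolding bilinear_on_def by auto

lemma tensor_sum_closed: "xs \<in> lists (carrier M \<times> carrier N) \<Longrightarrow> tensor_sum W \<beta> xs \<in> carrier W"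
  by (induction xs) (auto simp: bilinear_onD)

lemma tensor_sum_append: "xs \<in> lists (carrier M \<times> carrier N) \<Longrightarrow> ys \<in> lists (carrier M \<times> carrier N)
   \<Longrightarrow> tensor_sum W \<beta> (xs @ ys) = tensor_sum W \<beta> xs \<oplus>\<^bsub>W\<^esub> tensor_sum W \<beta> ys"
  by (induction xs) (auto simp: bilinear_onD tensor_sum_closed W.a_assoc)

lemma tensor_sum_smult: "xs \<in> lists (carrier M \<times> carrier N) \<Longrightarrow> c \<in> carrier F
   \<Longrightarrow> tensor_sum W \<beta> (map (\<lambda>(m, n). (c \<odot>\<^bsub>M\<^esub> m, n)) xs) = c \<odot>\<^bsub>W\<^esub> tensor_sum W \<beta> xs"
  by (induction xs) (auto simp: bilinear_onD tensor_sum_closed W.smult_r_distr)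

lemma tensor_sum_perm:
  "xs \<in> lists (carrier M \<times> carrier N) \<Longrightarrow> mset xs = mset ys \<Longrightarrow> tensor_sum W \<beta> xs = tensor_sum W \<beta> ys"
proof (induction xs arbitrary: ys)
  case (Cons z xs)
  have "z \<in> set ys" using Cons.prems by (metis list.set_intros(1) mset_eq_setD)
  then obtain us vs where ys: "ys = us @ z # vs" by (metis split_list)
  have "set ys \<subseteq> carrier M \<times> carrier N"
    using Cons.prems(1) mset_eq_setD[OF Cons.prems(2)] by (metis in_lists_conv_set subsetI)
  then have us: "us \<in> lists (carrier M \<times> carrier N)" "vs \<in> lists (carrier M \<times> carrier N)"
    using ys by (auto simp: in_lists_conv_set)
  have "mset xs = mset (us @ vs)" using Cons.prems ys by simp
  then have "tensor_sum W \<beta> xs = tensor_sum W \<beta> (us @ vs)" using Cons.IH Cons.prems(1) by auto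
  moreover obtain m n where "z = (m, n)" by force
  ultimately show ?case using us Cons.prems ys
    by (auto simp: tensor_sum_append tensor_sum_closed bilinear_onD W.a_lcomm)
qed simp

lemma tensor_sum_rel: "(xs, ys) \<in> tensor_rel F M N \<Longrightarrow> tensor_sum W \<beta> xs = tensor_sum W \<beta> ys"
proof (induction rule: tensor_rel.induct)
  case (perm xs ys)
  then show ?case by (rule tensor_sum_perm)
next
  case (Cons xs ys z)
  then show ?case by (cases z) simp
next
  case (zero n)
  have "\<beta> \<zero>\<^bsub>M\<^esub> n = \<zero>\<^bsub>W\<^esub>"
    using bilinear_onD(4)[of "\<zero>\<^bsub>F\<^esub>" "\<zero>\<^bsub>M\<^esub>" n] bilinear_onD(1)[of "\<zero>\<^bsub>M\<^esub>" n] zero by simp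
  then show ?case by simp
qed (auto simp: bilinear_onD)

lemma tensor_lift_class:
  assumes "xs \<in> lists (carrier M \<times> carrier N)"
  shows "tensor_lift W \<beta> (tensor_class F M N xs) = tensor_sum W \<beta> xs"
proof -
  have "xs \<in> tensor_class F M N xs" using assms by (auto simp: tensor_class_def intro: tensor_rel.perm)
  then have "(SOME ys. ys \<in> tensor_class F M N xs) \<in> tensor_class F M N xs" by (rule someI)
  then show ?thesis unfolding tensor_lift_def using tensor_sum_rel by (force simp: tensor_class_def)
qed

theorem tensor_universal:
  shows "linear_on F (tensor_space F M N) W (tensor_lift W \<beta>)"
    and "\<And>m n. m \<in> carrier M \<Longrightarrow> n \<in> carrier N \<Longrightarrow> tensor_lift W \<beta> (pure_tensor F M N m n) = \<beta> m n"
    and "\<And>h A. linear_on F (tensor_space F M N) W h \<Longrightarrow>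
      (\<And>m n. m \<in> carrier M \<Longrightarrow> n \<in> carrier N \<Longrightarrow> h (pure_tensor F M N m n) = \<beta> m n) \<Longrightarrow>
      A \<in> carrier (tensor_space F M N) \<Longrightarrow> h A = tensor_lift W \<beta> A"
proof -
  let ?T = "tensor_space F M N" and ?c = "tensor_class F M N"
  show "linear_on F ?T W (tensor_lift W \<beta>)"
    unfolding linear_on_def
    by (auto elim!: tensor_carrier_cases simp: tensor_lift_class tensor_sum_closed
        tensor_space_add[OF M N] tensor_space_smult[OF M N] tensor_sum_append tensor_sum_smult
        tensor_smult_list[OF M])
  show "tensor_lift W \<beta> (pure_tensor F M N m n) = \<beta> m n" if "m \<in> carrier M" "n \<in> carrier N" for m n
    using that by (simp add: pure_tensor_def tensor_lift_class bilinear_onD)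
  show "h A = tensor_lift W \<beta> A"
    if h: "linear_on F ?T W h" and
      pt: "\<And>m n. m \<in> carrier M \<Longrightarrow> n \<in> carrier N \<Longrightarrow> h (pure_tensor F M N m n) = \<beta> m n"
      and A: "A \<in> carrier ?T" for h A
  proof -
    interpret T: module F ?T by (rule tensor_space_module[OF M N])
    obtain xs where xs: "xs \<in> lists (carrier M \<times> carrier N)" "A = ?c xs"
      using A by (rule tensor_carrier_cases)
    have "h (?c xs) = tensor_sum W \<beta> xs" using xs(1)
    proof (induction xs)
      case Nil
      have "h (\<zero>\<^bsub>F\<^esub> \<odot>\<^bsub>?T\<^esub> \<zero>\<^bsub>?T\<^esub>) = \<zero>\<^bsub>F\<^esub> \<odot>\<^bsub>W\<^esub> h \<zero>\<^bsub>?T\<^esub>" "h \<zero>\<^bsub>?T\<^esub> \<in> carrier W"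
        using h T.zero_closed M.R.zero_closed unfolding linear_on_def by blast+
      then show ?case using tensor_class_closed[of "[]" M N F] T.smult_l_null[OF T.zero_closed]
        by (simp add: tensor_space_zero)
    next
      case (Cons z xs)
      obtain m n where z: "z = (m, n)" by force
      have "?c (z # xs) = pure_tensor F M N m n \<oplus>\<^bsub>?T\<^esub> ?c xs"
        using tensor_space_add[OF M N, of "[z]" xs] Cons.hyps z by (simp add: pure_tensor_def)
      then show ?case using h Cons pt[of m n] z tensor_class_closed[of "[z]" M N F]
          tensor_class_closed[of xs M N F]
        unfolding linear_on_def by (auto simp: pure_tensor_def)
    qed
    then show ?thesis using xs by (simp add: tensor_lift_class)
  qed
qed

end

end


section \<open>Poisson algebras\<close>

record ('f, 'p) poisson = "('f, 'p) module" +
  bracket :: "'p \<Rightarrow> 'p \<Rightarrow> 'p"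

text \<open>
  A Lie bracket is alternating, which is the standard requirement in every characteristic.
  \<^locale>\<open>algebra\<close> comprises commutative associative unital algebras.
\<close>

locale poisson_algebra = field F + algebra F P
  for F :: "('f, 'k) ring_scheme" (structure) and P :: "('f, 'p, 'x) poisson_scheme" (structure) +
  assumes bracket_closed:
      "\<lbrakk>x \<in> carrier P; y \<in> carrier P\<rbrakk> \<Longrightarrow> bracket P x y \<in> carrier P"
    and bracket_add_left:
      "\<lbrakk>x \<in> carrier P; y \<in> carrier P; z \<in> carrier P\<rbrakk>
        \<Longrightarrow> bracket P (x \<oplus>\<^bsub>P\<^esub> y) z = bracket P x z \<oplus>\<^bsub>P\<^esub> bracket P y z"
    and bracket_add_right:
      "\<lbrakk>x \<in> carrier P; y \<in> carrier P; z \<in> carrier P\<rbrakk>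
        \<Longrightarrow> bracket P x (y \<oplus>\<^bsub>P\<^esub> z) = bracket P x y \<oplus>\<^bsub>P\<^esub> bracket P x z"
    and bracket_smult_left:
      "\<lbrakk>c \<in> carrier F; x \<in> carrier P; y \<in> carrier P\<rbrakk>
        \<Longrightarrow> bracket P (c \<odot>\<^bsub>P\<^esub> x) y = c \<odot>\<^bsub>P\<^esub> bracket P x y"
    and bracket_smult_right:
      "\<lbrakk>c \<in> carrier F; x \<in> carrier P; y \<in> carrier P\<rbrakk>
        \<Longrightarrow> bracket P x (c \<odot>\<^bsub>P\<^esub> y) = c \<odot>\<^bsub>P\<^esub> bracket P x y"
    and bracket_alternating:
      "x \<in> carrier P \<Longrightarrow> bracket P x x = \<zero>\<^bsub>P\<^esub>"
    and jacobi:
      "\<lbrakk>x \<in> carrier P; y \<in> carrier P; z \<in> carrier P\<rbrakk>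
        \<Longrightarrow> bracket P x (bracket P y z) \<oplus>\<^bsub>P\<^esub> bracket P y (bracket P z x)
            \<oplus>\<^bsub>P\<^esub> bracket P z (bracket P x y) = \<zero>\<^bsub>P\<^esub>"
    and leibniz:
      "\<lbrakk>x \<in> carrier P; y \<in> carrier P; z \<in> carrier P\<rbrakk>
        \<Longrightarrow> bracket P x (y \<otimes>\<^bsub>P\<^esub> z) = bracket P x y \<otimes>\<^bsub>P\<^esub> z \<oplus>\<^bsub>P\<^esub> y \<otimes>\<^bsub>P\<^esub> bracket P x z"

definition poisson_hom ::
  "('f, 'k) ring_scheme \<Rightarrow> ('f, 'p, 'x) poisson_scheme \<Rightarrow> ('f, 'q, 'y) poisson_scheme
    \<Rightarrow> ('p \<Rightarrow> 'q) set"
  where "poisson_hom F P Q =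
    {h \<in> ring_hom P Q.
       (\<forall>c\<in>carrier F. \<forall>x\<in>carrier P. h (c \<odot>\<^bsub>P\<^esub> x) = c \<odot>\<^bsub>Q\<^esub> h x) \<and>
       (\<forall>x\<in>carrier P. \<forall>y\<in>carrier P. h (bracket P x y) = bracket Q (h x) (h y))}"

definition base_poisson :: "('f, 'k) ring_scheme \<Rightarrow> ('f, 'f) poisson"
  where "base_poisson F =
    \<lparr>carrier = carrier F, monoid.mult = monoid.mult F, one = one F, zero = zero F, add = add F,
     smult = monoid.mult F, bracket = (\<lambda>_ _. \<zero>\<^bsub>F\<^esub>)\<rparr>"

text \<open>
  Product and bracket of the tensor product are the bilinear extensions of
  \<open>(p \<otimes> q)(r \<otimes> s) = pr \<otimes> qs\<close> and \<open>[p \<otimes> q, r \<otimes> s] = pr \<otimes> [q, s] + [p, r] \<otimes> qs\<close>.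
\<close>

definition tensor_poisson ::
  "('f, 'k) ring_scheme \<Rightarrow> ('f, 'p, 'x) poisson_scheme \<Rightarrow> ('f, 'q, 'y) poisson_scheme
    \<Rightarrow> ('f, ('p \<times> 'q) list set) poisson"
  where "tensor_poisson F P Q =
    (let T = tensor_space F P Q; pt = pure_tensor F P Q in
     \<lparr>carrier = carrier T,
      monoid.mult = (\<lambda>A B. tensor_lift T (\<lambda>p q. tensor_lift T (\<lambda>r s. pt (p \<otimes>\<^bsub>P\<^esub> r) (q \<otimes>\<^bsub>Q\<^esub> s)) B) A),
      one = pt \<one>\<^bsub>P\<^esub> \<one>\<^bsub>Q\<^esub>,
      zero = zero T, add = add T, smult = smult T,
      bracket = (\<lambda>A B. tensor_lift T (\<lambda>p q. tensor_lift T
        (\<lambda>r s. pt (p \<otimes>\<^bsub>P\<^esub> r) (bracket Q q s) \<oplus>\<^bsub>T\<^esub> pt (bracket P p r) (q \<otimes>\<^bsub>Q\<^esub> s)) B) A)\<rparr>)"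


section \<open>Poisson bialgebras\<close>

definition coassociative ::
  "('f, 'k) ring_scheme \<Rightarrow> ('f, 'b, 'x) module_scheme \<Rightarrow> ('b \<Rightarrow> ('b \<times> 'b) list set) \<Rightarrow> bool"
  where "coassociative F B \<Delta> \<longleftrightarrow>
    (\<forall>b\<in>carrier B.
       tensor_assoc F B B B (tensor_map F (tensor_space F B B) B \<Delta> id (\<Delta> b)) =
       tensor_map F B (tensor_space F B B) id \<Delta> (\<Delta> b))"

text \<open>
  The counit laws \<open>(\<epsilon> \<otimes> id) \<circ> \<Delta> = id = (id \<otimes> \<epsilon>) \<circ> \<Delta>\<close>, composed with the canonical isomorphisms
  \<open>F \<otimes> B \<rightarrow> B\<close> and \<open>B \<otimes> F \<rightarrow> B\<close>.
\<close>

definition counital ::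
  "('f, 'k) ring_scheme \<Rightarrow> ('f, 'b, 'x) module_scheme \<Rightarrow> ('b \<Rightarrow> ('b \<times> 'b) list set)
    \<Rightarrow> ('b \<Rightarrow> 'f) \<Rightarrow> bool"
  where "counital F B \<Delta> \<epsilon> \<longleftrightarrow>
    (\<forall>b\<in>carrier B.
       tensor_lift B (\<lambda>c x. c \<odot>\<^bsub>B\<^esub> x) (tensor_map F (base_poisson F) B \<epsilon> id (\<Delta> b)) = b \<and>
       tensor_lift B (\<lambda>x c. c \<odot>\<^bsub>B\<^esub> x) (tensor_map F B (base_poisson F) id \<epsilon> (\<Delta> b)) = b)"

definition poisson_bialgebra ::
  "('f, 'k) ring_scheme \<Rightarrow> ('f, 'b, 'x) poisson_scheme \<Rightarrow> ('b \<Rightarrow> ('b \<times> 'b) list set)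
    \<Rightarrow> ('b \<Rightarrow> 'f) \<Rightarrow> bool"
  where "poisson_bialgebra F B \<Delta> \<epsilon> \<longleftrightarrow>
    poisson_algebra F B \<and>
    \<Delta> \<in> poisson_hom F B (tensor_poisson F B B) \<and>
    \<epsilon> \<in> poisson_hom F B (base_poisson F) \<and>
    coassociative F B \<Delta> \<and>
    counital F B \<Delta> \<epsilon>"


section \<open>The universal coacting Poisson algebra\<close>

text \<open>
  The test algebras \<open>Q\<close> range over all Poisson algebras whose carrier is a subset of the type \<open>'q\<close>;
  maps are compared on carriers only.
\<close>

definition universal_coacting ::
  "'q itself \<Rightarrow> ('f, 'k) ring_scheme \<Rightarrow> ('f, 'p, 'x) poisson_scheme \<Rightarrow> ('f, 'u, 'y) poisson_scheme
    \<Rightarrow> ('f, 'b, 'z) poisson_scheme \<Rightarrow> ('p \<Rightarrow> ('u \<times> 'b) list set) \<Rightarrow> bool"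
  where "universal_coacting (_ :: 'q itself) F P U B \<psi> \<longleftrightarrow>
    poisson_algebra F B \<and>
    \<psi> \<in> poisson_hom F P (tensor_poisson F U B) \<and>
    (\<forall>Q :: ('f, 'q) poisson. poisson_algebra F Q \<longrightarrow>
      (\<forall>h \<in> poisson_hom F P (tensor_poisson F U Q).
        \<exists>k \<in> poisson_hom F B Q.
          (\<forall>p\<in>carrier P. tensor_map F U Q id k (\<psi> p) = h p) \<and>
          (\<forall>k' \<in> poisson_hom F B Q.
            (\<forall>p\<in>carrier P. tensor_map F U Q id k' (\<psi> p) = h p) \<longrightarrow>
            (\<forall>b\<in>carrier B. k' b = k b))))"

text \<open>
  HOL cannot quantify over the type of the test algebras inside a formula, so it has to be fixed.
  The type below is large enough for universality with respect to it to be equivalent to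
  universality with respect to every type: as \<open>U\<close> is finite dimensional, a morphism \<open>P \<rightarrow> U \<otimes> Q\<close>
  takes values in \<open>U \<otimes> Q'\<close> for a subalgebra \<open>Q' \<subseteq> Q\<close> with at most \<open>max(|P|, \<aleph>\<^sub>0)\<close> generators, two
  morphisms \<open>B \<rightarrow> Q\<close> take values in a common subalgebra with at most \<open>max(|B|, \<aleph>\<^sub>0)\<close> generators, and
  every such subalgebra has an isomorphic copy whose carrier is a subset of this type.
\<close>

type_synonym ('f, 'p, 'b) test_universe = "('f + 'p + 'b) list"

end

theory Submission
  imports Defs
begin

text \<open>
  Write \<open>\<phi> = \<psi> \<circ> f : U \<rightarrow> U \<otimes> B\<close>.  By universality of \<open>B\<close>, a morphism \<open>B \<rightarrow> Q\<close> is the same as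
  a morphism \<open>P \<rightarrow> U \<otimes> Q\<close>.  The comultiplication \<open>\<Delta>\<close> is the morphism that corresponds to
  \<open>(\<phi> \<otimes> id) \<circ> \<psi> : P \<rightarrow> (U \<otimes> B) \<otimes> B \<cong> U \<otimes> (B \<otimes> B)\<close>, so that up to the associator
  \<open>(id \<otimes> \<Delta>) \<circ> \<psi> = (\<phi> \<otimes> id) \<circ> \<psi>\<close>.  Under the same correspondence both
  \<open>(\<Delta> \<otimes> id) \<circ> \<Delta>\<close> and \<open>(id \<otimes> \<Delta>) \<circ> \<Delta>\<close> become \<open>P \<rightarrow> U \<otimes> B\<close> followed by \<open>\<phi>\<close> twice, up to
  rebracketing, and the pentagon identity (\<open>tensor_assoc_pentagon\<close>) identifies the rebracketings:
  this is \<open>coaction_coassociative\<close>.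

  The counit \<open>\<epsilon>\<close> corresponds to \<open>g\<close>, that is, \<open>(id \<otimes> \<epsilon>)(\<psi>(p)) = g(p) \<otimes> 1\<close>.  Then
  \<open>(\<epsilon> \<otimes> id) \<circ> \<Delta>\<close> corresponds to \<open>((g \<circ> f) \<otimes> id) \<circ> \<psi>\<close> and \<open>(id \<otimes> \<epsilon>) \<circ> \<Delta>\<close> to \<open>\<psi> \<circ> f \<circ> g\<close>
  (\<open>coaction_counit_left\<close>, \<open>coaction_counit_right\<close>).  The two conditions on \<open>g\<close> say that both equal
  \<open>\<psi>\<close>, which corresponds to the identity of \<open>B\<close>.

  For these arguments tensor products of Poisson algebras must be Poisson algebras
  (\<open>tensor_poisson_algebra\<close>), and the associator, tensor products of morphisms and the unit
  isomorphisms must be morphisms; all of the latter follow from one criterion,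
  \<open>poisson_hom_from_tensor\<close>.

  Universality is only assumed for test algebras carried by subsets of one fixed type of lists, while
  \<open>F\<close>, \<open>B\<close>, \<open>B \<otimes> B\<close> and \<open>B \<otimes> (B \<otimes> B)\<close> live in other types.  Choosing a representing
  formal sum for each tensor embeds all of them into that type (\<open>tensor_space_embedding\<close>), and an
  isomorphic copy can be used in place of the algebra itself (\<open>universal_coacting_exists\<close>,
  \<open>universal_coacting_unique\<close>).
\<close>


section \<open>Linear and bilinear maps\<close>

lemma linear_onI:
  assumes "\<And>x. x \<in> carrier M \<Longrightarrow> h x \<in> carrier W"
    and "\<And>x y. x \<in> carrier M \<Longrightarrow> y \<in> carrier M \<Longrightarrow> h (x \<oplus>\<^bsub>M\<^esub> y) = h x \<oplus>\<^bsub>W\<^esub> h y"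
    and "\<And>c x. c \<in> carrier F \<Longrightarrow> x \<in> carrier M \<Longrightarrow> h (c \<odot>\<^bsub>M\<^esub> x) = c \<odot>\<^bsub>W\<^esub> h x"
  shows "linear_on F M W h"
  using assms unfolding linear_on_def by blast

lemma linear_onD:
  assumes "linear_on F M W h"
  shows "x \<in> carrier M \<Longrightarrow> h x \<in> carrier W"
    and "x \<in> carrier M \<Longrightarrow> y \<in> carrier M \<Longrightarrow> h (x \<oplus>\<^bsub>M\<^esub> y) = h x \<oplus>\<^bsub>W\<^esub> h y"
    and "c \<in> carrier F \<Longrightarrow> x \<in> carrier M \<Longrightarrow> h (c \<odot>\<^bsub>M\<^esub> x) = c \<odot>\<^bsub>W\<^esub> h x"
  using assms unfolding linear_on_def by blast+

lemma linear_on_id: "linear_on F M M id"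
  by (rule linear_onI) auto

lemma linear_on_comp:
  assumes "linear_on F M N f" "linear_on F N W g"
  shows "linear_on F M W (g \<circ> f)"
  by (rule linear_onI) (simp_all add: linear_onD[OF assms(1)] linear_onD[OF assms(2)])

lemma linear_on_cong:
  assumes M: "module F M" and "linear_on F M W f" "\<And>x. x \<in> carrier M \<Longrightarrow> g x = f x"
  shows "linear_on F M W g"
proof -
  interpret module F M by fact
  show ?thesis using assms(2,3) unfolding linear_on_def by auto
qed

lemma linear_on_zero:
  assumes M: "module F M" and W: "module F W" and h: "linear_on F M W h"
  shows "h \<zero>\<^bsub>M\<^esub> = \<zero>\<^bsub>W\<^esub>"
proof -
  interpret M: module F M by fact
  interpret W: module F W by fact
  have "h (\<zero>\<^bsub>F\<^esub> \<odot>\<^bsub>M\<^esub> \<zero>\<^bsub>M\<^esub>) = \<zero>\<^bsub>F\<^esub> \<odot>\<^bsub>W\<^esub> h \<zero>\<^bsub>M\<^esub>"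
    by (rule linear_onD(3)[OF h]) auto
  then show ?thesis using linear_onD(1)[OF h M.M.zero_closed] by simp
qed

lemma linear_on_minus:
  assumes M: "module F M" and W: "module F W" and h: "linear_on F M W h"
    and x: "x \<in> carrier M"
  shows "h (\<ominus>\<^bsub>M\<^esub> x) = \<ominus>\<^bsub>W\<^esub> h x"
proof -
  interpret M: module F M by fact
  interpret W: module F W by fact
  have "h (\<ominus>\<^bsub>M\<^esub> x) \<oplus>\<^bsub>W\<^esub> h x = h (\<ominus>\<^bsub>M\<^esub> x \<oplus>\<^bsub>M\<^esub> x)"
    using x by (simp add: linear_onD[OF h])
  also have "\<dots> = \<zero>\<^bsub>W\<^esub>"
    using x by (simp add: M.M.l_neg linear_on_zero[OF M W h])
  finally show ?thesis
    using x by (metis M.M.a_inv_closed W.M.minus_equality linear_onD(1)[OF h])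
qed

lemma linear_on_add:
  assumes M: "module F M" and W: "module F W"
    and f: "linear_on F M W f" and g: "linear_on F M W g"
  shows "linear_on F M W (\<lambda>x. f x \<oplus>\<^bsub>W\<^esub> g x)"
proof -
  interpret M: module F M by fact
  interpret W: module F W by fact
  show ?thesis
    by (rule linear_onI)
      (simp_all add: linear_onD[OF f] linear_onD[OF g] W.smult_r_distr W.M.a_ac)
qed

text \<open>
  This reduces every bilinearity question below to the calculus of linear maps.
\<close>

lemma bilinear_on_iff:
  "bilinear_on F M N W \<beta> \<longleftrightarrow>
    (\<forall>n\<in>carrier N. linear_on F M W (\<lambda>m. \<beta> m n)) \<and> (\<forall>m\<in>carrier M. linear_on F N W (\<beta> m))"
  unfolding bilinear_on_def linear_on_def by fast


section \<open>Maps out of a tensor product\<close>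

context
  fixes F :: "('f, 'k) ring_scheme" and M :: "('f, 'm, 'x) module_scheme"
    and N :: "('f, 'n, 'y) module_scheme"
  assumes M: "module F M" and N: "module F N"
begin

interpretation M: module F M by (rule M)
interpretation N: module F N by (rule N)
interpretation T: module F "tensor_space F M N" by (rule tensor_space_module[OF M N])

lemma pure_tensor_closed:
  "m \<in> carrier M \<Longrightarrow> n \<in> carrier N \<Longrightarrow> pure_tensor F M N m n \<in> carrier (tensor_space F M N)"
  unfolding pure_tensor_def by (rule tensor_class_closed) auto

lemma pure_tensor_bilinear: "bilinear_on F M N (tensor_space F M N) (pure_tensor F M N)"
proof -
  have eq: "tensor_class F M N xs = tensor_class F M N ys" if "(xs, ys) \<in> tensor_rel F M N" for xs ys
    using that tensor_rel_carrier[OF M N that] tensor_class_eq_iff[OF M N] by blast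
  show ?thesis
    unfolding bilinear_on_iff
  proof (intro conjI ballI linear_onI pure_tensor_closed)
    fix m n n' assume "m \<in> carrier M" "n \<in> carrier N" "n' \<in> carrier N"
    then show "pure_tensor F M N m (n \<oplus>\<^bsub>N\<^esub> n')
        = pure_tensor F M N m n \<oplus>\<^bsub>tensor_space F M N\<^esub> pure_tensor F M N m n'"
      using eq[OF tensor_rel.add_right, of m n n']
      by (simp add: pure_tensor_def tensor_space_add[OF M N])
  next
    fix m m' n assume "m \<in> carrier M" "m' \<in> carrier M" "n \<in> carrier N"
    then show "pure_tensor F M N (m \<oplus>\<^bsub>M\<^esub> m') n
        = pure_tensor F M N m n \<oplus>\<^bsub>tensor_space F M N\<^esub> pure_tensor F M N m' n"
      using eq[OF tensor_rel.add_left, of m m' n]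
      by (simp add: pure_tensor_def tensor_space_add[OF M N])
  next
    fix c m n assume a: "c \<in> carrier F" "m \<in> carrier M" "n \<in> carrier N"
    then show *: "pure_tensor F M N (c \<odot>\<^bsub>M\<^esub> m) n = c \<odot>\<^bsub>tensor_space F M N\<^esub> pure_tensor F M N m n"
      by (simp add: pure_tensor_def tensor_space_smult[OF M N])
    show "pure_tensor F M N m (c \<odot>\<^bsub>N\<^esub> n) = c \<odot>\<^bsub>tensor_space F M N\<^esub> pure_tensor F M N m n"
      unfolding *[symmetric] using eq[OF tensor_rel.balanced, of c m n] a
      by (simp add: pure_tensor_def)
  qed auto
qed

lemmas pure_tensor_linear =
  bspec[OF conjunct1[OF iffD1[OF bilinear_on_iff pure_tensor_bilinear]]]
  bspec[OF conjunct2[OF iffD1[OF bilinear_on_iff pure_tensor_bilinear]]]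

lemmas pure_tensor_simps =
  pure_tensor_closed
  linear_onD(2,3)[OF pure_tensor_linear(1)] linear_onD(2,3)[OF pure_tensor_linear(2)]
  linear_on_zero[OF M tensor_space_module[OF M N] pure_tensor_linear(1)]
  linear_on_zero[OF N tensor_space_module[OF M N] pure_tensor_linear(2)]
  linear_on_minus[OF M tensor_space_module[OF M N] pure_tensor_linear(1)]
  linear_on_minus[OF N tensor_space_module[OF M N] pure_tensor_linear(2)]

text \<open>The pure case covers zero, which is \<open>0 \<otimes> 0\<close>.\<close>

lemma tensor_induct [consumes 1, case_names pure add]:
  assumes "A \<in> carrier (tensor_space F M N)"
    and pure: "\<And>m n. m \<in> carrier M \<Longrightarrow> n \<in> carrier N \<Longrightarrow> Pr (pure_tensor F M N m n)"
    and add: "\<And>A B. A \<in> carrier (tensor_space F M N) \<Longrightarrow> B \<in> carrier (tensor_space F M N) \<Longrightarrow>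
      Pr A \<Longrightarrow> Pr B \<Longrightarrow> Pr (A \<oplus>\<^bsub>tensor_space F M N\<^esub> B)"
  shows "Pr A"
proof -
  obtain xs where xs: "xs \<in> lists (carrier M \<times> carrier N)" "A = tensor_class F M N xs"
    using assms(1) by (rule tensor_carrier_cases)
  have "Pr (tensor_class F M N xs)"
    using xs(1)
  proof (induction xs)
    case Nil
    show ?case
      using pure[OF M.M.zero_closed N.M.zero_closed]
      by (simp add: pure_tensor_simps tensor_space_zero)
  next
    case (Cons z xs)
    obtain m n where z: "z = (m, n)" "m \<in> carrier M" "n \<in> carrier N"
      using Cons.hyps(1) by auto
    have "tensor_class F M N (z # xs)
        = pure_tensor F M N m n \<oplus>\<^bsub>tensor_space F M N\<^esub> tensor_class F M N xs"
      using tensor_space_add[OF M N, of "[z]" xs] Cons.hyps z by (simp add: pure_tensor_def)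
    then show ?case
      using z Cons tensor_class_closed[of xs M N F] by (simp add: add pure pure_tensor_closed)
  qed
  then show ?thesis by (simp only: xs(2))
qed

lemma tensor_ext:
  assumes f: "linear_on F (tensor_space F M N) W f" and g: "linear_on F (tensor_space F M N) W g"
    and "\<And>m n. m \<in> carrier M \<Longrightarrow> n \<in> carrier N \<Longrightarrow> f (pure_tensor F M N m n) = g (pure_tensor F M N m n)"
    and "A \<in> carrier (tensor_space F M N)"
  shows "f A = g A"
  using assms(4) by (induction rule: tensor_induct) (simp_all add: assms(3) linear_onD[OF f] linear_onD[OF g])

text \<open>
  Linearity in a parameter passes through \<open>tensor_lift\<close>: it holds on pure tensors, and a sum of
  linear maps is linear.  Associator, product and bracket are all defined by nested lifts, and their
  bilinearity rests on this.
\<close>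

lemma tensor_lift_param_linear:
  assumes L: "module F L" and W: "module F W"
    and bil: "\<And>l. l \<in> carrier L \<Longrightarrow> bilinear_on F M N W (\<gamma> l)"
    and lin: "\<And>m n. m \<in> carrier M \<Longrightarrow> n \<in> carrier N \<Longrightarrow> linear_on F L W (\<lambda>l. \<gamma> l m n)"
    and A: "A \<in> carrier (tensor_space F M N)"
  shows "linear_on F L W (\<lambda>l. tensor_lift W (\<gamma> l) A)"
  using A
proof (induction rule: tensor_induct)
  case (pure m n)
  then show ?case
    by (intro linear_on_cong[OF L lin]) (auto simp: tensor_universal(2)[OF M N W bil])
next
  case (add A B)
  then show ?case
    by (intro linear_on_cong[OF L linear_on_add[OF L W add.IH]])
      (auto simp: linear_onD[OF tensor_universal(1)[OF M N W bil]])
qed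

end

text \<open>
  A map that is bilinear in \<open>(m, n)\<close> and in \<open>(m', n')\<close> induces a bilinear map on two tensor
  products.  Product and bracket of a tensor product of Poisson algebras are of this form.
\<close>

lemma tensor_lift2:
  assumes M: "module F M" and N: "module F N" and M': "module F M'" and N': "module F N'"
    and W: "module F W"
    and 1: "\<And>m n. m \<in> carrier M \<Longrightarrow> n \<in> carrier N \<Longrightarrow> bilinear_on F M' N' W (\<gamma> m n)"
    and 2: "\<And>m' n'. m' \<in> carrier M' \<Longrightarrow> n' \<in> carrier N' \<Longrightarrow> bilinear_on F M N W (\<lambda>m n. \<gamma> m n m' n')"
  shows "bilinear_on F (tensor_space F M N) (tensor_space F M' N') W
      (\<lambda>A B. tensor_lift W (\<lambda>m n. tensor_lift W (\<gamma> m n) B) A)"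
    and "\<And>m n m' n'. m \<in> carrier M \<Longrightarrow> n \<in> carrier N \<Longrightarrow> m' \<in> carrier M' \<Longrightarrow> n' \<in> carrier N' \<Longrightarrow>
      tensor_lift W (\<lambda>m n. tensor_lift W (\<gamma> m n) (pure_tensor F M' N' m' n')) (pure_tensor F M N m n)
        = \<gamma> m n m' n'"
proof -
  have bil: "bilinear_on F M N W (\<lambda>m n. tensor_lift W (\<gamma> m n) B)"
    if B: "B \<in> carrier (tensor_space F M' N')" for B
    unfolding bilinear_on_iff
    using 2 B unfolding bilinear_on_iff
    by (auto intro!: tensor_lift_param_linear[OF M' N' M W] tensor_lift_param_linear[OF M' N' N W] 1)
  show "bilinear_on F (tensor_space F M N) (tensor_space F M' N') W
      (\<lambda>A B. tensor_lift W (\<lambda>m n. tensor_lift W (\<gamma> m n) B) A)"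
    unfolding bilinear_on_iff
    by (auto intro!: tensor_universal(1)[OF M N W] bil tensor_lift_param_linear[OF M N _ W]
        tensor_space_module M' N' tensor_universal(1)[OF M' N' W] 1)
  fix m n m' n'
  assume a: "m \<in> carrier M" "n \<in> carrier N" "m' \<in> carrier M'" "n' \<in> carrier N'"
  then show "tensor_lift W (\<lambda>m n. tensor_lift W (\<gamma> m n) (pure_tensor F M' N' m' n')) (pure_tensor F M N m n)
        = \<gamma> m n m' n'"
    by (simp add: tensor_universal(2)[OF M N W bil] tensor_universal(2)[OF M' N' W 1]
        pure_tensor_closed[OF M' N'])
qed

lemma tensor_map:
  assumes M: "module F M" and N: "module F N" and M': "module F M'" and N': "module F N'"
    and f: "linear_on F M M' f" and g: "linear_on F N N' g"
  shows tensor_map_linear: "linear_on F (tensor_space F M N) (tensor_space F M' N') (tensor_map F M' N' f g)"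
    and tensor_map_pure: "\<And>m n. m \<in> carrier M \<Longrightarrow> n \<in> carrier N \<Longrightarrow>
      tensor_map F M' N' f g (pure_tensor F M N m n) = pure_tensor F M' N' (f m) (g n)"
proof -
  have "bilinear_on F M N (tensor_space F M' N') (\<lambda>m n. pure_tensor F M' N' (f m) (g n))"
    unfolding bilinear_on_def
    by (simp add: pure_tensor_simps[OF M' N'] linear_onD[OF f] linear_onD[OF g])
  note * = tensor_universal[OF M N tensor_space_module[OF M' N'] this]
  show "linear_on F (tensor_space F M N) (tensor_space F M' N') (tensor_map F M' N' f g)"
    unfolding tensor_map_def by (rule *(1))
  show "tensor_map F M' N' f g (pure_tensor F M N m n) = pure_tensor F M' N' (f m) (g n)"
    if "m \<in> carrier M" "n \<in> carrier N" for m n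
    unfolding tensor_map_def by (rule *(2)[OF that])
qed

lemma tensor_map_cong:
  assumes M: "module F M" and N: "module F N" and M': "module F M'" and N': "module F N'"
    and f: "linear_on F M M' f" and g: "linear_on F N N' g"
    and f': "\<And>m. m \<in> carrier M \<Longrightarrow> f' m = f m" and g': "\<And>n. n \<in> carrier N \<Longrightarrow> g' n = g n"
    and A: "A \<in> carrier (tensor_space F M N)"
  shows "tensor_map F M' N' f' g' A = tensor_map F M' N' f g A"
  using A
  by (rule tensor_ext[OF M N tensor_map_linear tensor_map_linear, rotated -1])
    (auto simp: tensor_map_pure[OF M N M' N' linear_on_cong[OF M f f'] linear_on_cong[OF N g g']]
      tensor_map_pure[OF M N M' N' f g] f' g' intro: assms linear_on_cong[OF M f f'] linear_on_cong[OF N g g'])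

lemma tensor_map_comp:
  assumes M: "module F M" and N: "module F N" and M': "module F M'" and N': "module F N'"
    and M'': "module F M''" and N'': "module F N''"
    and f: "linear_on F M M' f" and g: "linear_on F N N' g"
    and f': "linear_on F M' M'' f'" and g': "linear_on F N' N'' g'"
    and A: "A \<in> carrier (tensor_space F M N)"
  shows "tensor_map F M'' N'' f' g' (tensor_map F M' N' f g A) = tensor_map F M'' N'' (f' \<circ> f) (g' \<circ> g) A"
proof -
  note fg = tensor_map_linear[OF M N M' N' f g] tensor_map_linear[OF M' N' M'' N'' f' g']
  show ?thesis
    using tensor_ext[OF M N linear_on_comp[OF fg]
      tensor_map_linear[OF M N M'' N'' linear_on_comp[OF f f'] linear_on_comp[OF g g']] _ A]
    by (simp add: tensor_map_pure[OF M N M' N' f g] tensor_map_pure[OF M' N' M'' N'' f' g']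
        tensor_map_pure[OF M N M'' N'' linear_on_comp[OF f f'] linear_on_comp[OF g g']]
        linear_onD[OF f] linear_onD[OF g])
qed

lemma tensor_map_id:
  assumes M: "module F M" and N: "module F N" and A: "A \<in> carrier (tensor_space F M N)"
  shows "tensor_map F M N id id A = A"
  using tensor_ext[OF M N tensor_map_linear[OF M N M N linear_on_id linear_on_id] linear_on_id _ A]
  by (simp add: tensor_map_pure[OF M N M N linear_on_id linear_on_id])

lemma tensor_assoc:
  assumes M: "module F M" and N: "module F N" and L: "module F L"
  shows tensor_assoc_linear: "linear_on F (tensor_space F (tensor_space F M N) L)
      (tensor_space F M (tensor_space F N L)) (tensor_assoc F M N L)"
    and tensor_assoc_pure: "\<And>m n l. m \<in> carrier M \<Longrightarrow> n \<in> carrier N \<Longrightarrow> l \<in> carrier L \<Longrightarrow>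
      tensor_assoc F M N L (pure_tensor F (tensor_space F M N) L (pure_tensor F M N m n) l)
        = pure_tensor F M (tensor_space F N L) m (pure_tensor F N L n l)"
proof -
  let ?W = "tensor_space F M (tensor_space F N L)"
  let ?\<gamma> = "\<lambda>l m n. pure_tensor F M (tensor_space F N L) m (pure_tensor F N L n l)"
  note MN = tensor_space_module[OF M N] and NL = tensor_space_module[OF N L]
  note W = tensor_space_module[OF M NL]
  have bil: "bilinear_on F M N ?W (?\<gamma> l)" if "l \<in> carrier L" for l
    using that unfolding bilinear_on_def
    by (simp add: pure_tensor_simps[OF M NL] pure_tensor_simps[OF N L])
  have lin: "linear_on F L ?W (\<lambda>l. ?\<gamma> l m n)" if "m \<in> carrier M" "n \<in> carrier N" for m n
    using that by (intro linear_onI)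
      (simp_all add: pure_tensor_simps[OF M NL] pure_tensor_simps[OF N L])
  have "bilinear_on F (tensor_space F M N) L ?W (\<lambda>t l. tensor_lift ?W (?\<gamma> l) t)"
    unfolding bilinear_on_iff
    using tensor_universal(1)[OF M N W bil] tensor_lift_param_linear[OF M N L W bil lin] by blast
  note * = tensor_universal[OF MN L W this]
  show "linear_on F (tensor_space F (tensor_space F M N) L) ?W (tensor_assoc F M N L)"
    unfolding tensor_assoc_def Let_def by (rule *(1))
  show "tensor_assoc F M N L (pure_tensor F (tensor_space F M N) L (pure_tensor F M N m n) l)
        = pure_tensor F M (tensor_space F N L) m (pure_tensor F N L n l)"
    if a: "m \<in> carrier M" "n \<in> carrier N" "l \<in> carrier L" for m n l
    using a unfolding tensor_assoc_def Let_def
    by (simp add: *(2) pure_tensor_closed[OF M N] tensor_universal(2)[OF M N W bil])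
qed

text \<open>
  The pure tensors \<open>(m \<otimes> n) \<otimes> l\<close> alone generate \<open>(M \<otimes> N) \<otimes> L\<close>: extend linearly in the left factor first.
\<close>

lemma tensor_ext3:
  assumes M: "module F M" and N: "module F N" and L: "module F L"
    and f: "linear_on F (tensor_space F (tensor_space F M N) L) W f"
    and g: "linear_on F (tensor_space F (tensor_space F M N) L) W g"
    and eq: "\<And>m n l. m \<in> carrier M \<Longrightarrow> n \<in> carrier N \<Longrightarrow> l \<in> carrier L \<Longrightarrow>
      f (pure_tensor F (tensor_space F M N) L (pure_tensor F M N m n) l)
      = g (pure_tensor F (tensor_space F M N) L (pure_tensor F M N m n) l)"
    and A: "A \<in> carrier (tensor_space F (tensor_space F M N) L)"
  shows "f A = g A"
proof (rule tensor_ext[OF tensor_space_module[OF M N] L f g _ A])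
  fix t l assume t: "t \<in> carrier (tensor_space F M N)" and l: "l \<in> carrier L"
  let ?i = "\<lambda>t. pure_tensor F (tensor_space F M N) L t l"
  note i = pure_tensor_linear(1)[OF tensor_space_module[OF M N] L l]
  show "f (?i t) = g (?i t)"
    using tensor_ext[OF M N linear_on_comp[OF i f] linear_on_comp[OF i g] _ t] eq[OF _ _ l] by simp
qed

lemma tensor_assoc_natural:
  assumes M: "module F M" and N: "module F N" and L: "module F L"
    and M': "module F M'" and N': "module F N'" and L': "module F L'"
    and f: "linear_on F M M' f" and g: "linear_on F N N' g" and h: "linear_on F L L' h"
    and A: "A \<in> carrier (tensor_space F (tensor_space F M N) L)"
  shows "tensor_assoc F M' N' L' (tensor_map F (tensor_space F M' N') L' (tensor_map F M' N' f g) h A)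
    = tensor_map F M' (tensor_space F N' L') f (tensor_map F N' L' g h) (tensor_assoc F M N L A)"
proof -
  note MN = tensor_space_module[OF M N] and NL = tensor_space_module[OF N L]
    and MN' = tensor_space_module[OF M' N'] and NL' = tensor_space_module[OF N' L']
  note fg = tensor_map_linear[OF M N M' N' f g] and gh = tensor_map_linear[OF N L N' L' g h]
  note fgh = tensor_map_linear[OF MN L MN' L' fg h] and fgh' = tensor_map_linear[OF M NL M' NL' f gh]
  note a = tensor_assoc_linear[OF M N L] and a' = tensor_assoc_linear[OF M' N' L']
  show ?thesis
    using tensor_ext3[OF M N L linear_on_comp[OF fgh a'] linear_on_comp[OF a fgh'] _ A]
    by (simp add: tensor_assoc_pure[OF M N L] tensor_assoc_pure[OF M' N' L']
        tensor_map_pure[OF M N M' N' f g] tensor_map_pure[OF N L N' L' g h]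
        tensor_map_pure[OF MN L MN' L' fg h] tensor_map_pure[OF M NL M' NL' f gh]
        pure_tensor_closed[OF M N] pure_tensor_closed[OF N L]
        linear_onD[OF f] linear_onD[OF g] linear_onD[OF h])
qed


text \<open>
  Both sides send \<open>((m \<otimes> n) \<otimes> l) \<otimes> k\<close> to \<open>m \<otimes> (n \<otimes> (l \<otimes> k))\<close>.
\<close>

lemma tensor_assoc_pentagon:
  assumes M: "module F M" and N: "module F N" and L: "module F L" and K: "module F K"
    and A: "A \<in> carrier (tensor_space F (tensor_space F (tensor_space F M N) L) K)"
  shows "tensor_map F M (tensor_space F N (tensor_space F L K)) id (tensor_assoc F N L K)
      (tensor_assoc F M (tensor_space F N L) K
        (tensor_map F (tensor_space F M (tensor_space F N L)) K (tensor_assoc F M N L) id A))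
    = tensor_assoc F M N (tensor_space F L K) (tensor_assoc F (tensor_space F M N) L K A)"
proof -
  note MN = tensor_space_module[OF M N] and NL = tensor_space_module[OF N L]
    and LK = tensor_space_module[OF L K]
  note MN_L = tensor_space_module[OF MN L] and M_NL = tensor_space_module[OF M NL]
    and NL_K = tensor_space_module[OF NL K] and N_LK = tensor_space_module[OF N LK]
  note a1 = tensor_assoc_linear[OF M N L] and a2 = tensor_assoc_linear[OF M NL K]
    and a3 = tensor_assoc_linear[OF N L K] and a4 = tensor_assoc_linear[OF MN L K]
    and a5 = tensor_assoc_linear[OF M N LK]
  note m1 = tensor_map_linear[OF MN_L K M_NL K a1 linear_on_id]
    and m2 = tensor_map_linear[OF M NL_K M N_LK linear_on_id a3]
  note lhs = linear_on_comp[OF linear_on_comp[OF m1 a2] m2] and rhs = linear_on_comp[OF a4 a5]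
  let ?f = "tensor_map F M (tensor_space F N (tensor_space F L K)) id (tensor_assoc F N L K)
      \<circ> (tensor_assoc F M (tensor_space F N L) K
        \<circ> tensor_map F (tensor_space F M (tensor_space F N L)) K (tensor_assoc F M N L) id)"
  let ?g = "tensor_assoc F M N (tensor_space F L K) \<circ> tensor_assoc F (tensor_space F M N) L K"
  have "?f A = ?g A"
  proof (rule tensor_ext[OF MN_L K lhs rhs _ A])
    fix t k assume t: "t \<in> carrier (tensor_space F (tensor_space F M N) L)" and k: "k \<in> carrier K"
    let ?i = "\<lambda>t. pure_tensor F (tensor_space F (tensor_space F M N) L) K t k"
    note i = pure_tensor_linear(1)[OF MN_L K k]
    have "(?f \<circ> ?i) t = (?g \<circ> ?i) t"
      by (rule tensor_ext3[OF M N L linear_on_comp[OF i lhs] linear_on_comp[OF i rhs] _ t])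
        (simp add: k pure_tensor_closed[OF M N] pure_tensor_closed[OF MN L] pure_tensor_closed[OF N L]
          pure_tensor_closed[OF L K] pure_tensor_closed[OF NL K]
          tensor_map_pure[OF MN_L K M_NL K a1 linear_on_id] tensor_map_pure[OF M NL_K M N_LK linear_on_id a3]
          tensor_assoc_pure[OF M N L] tensor_assoc_pure[OF M NL K] tensor_assoc_pure[OF N L K]
          tensor_assoc_pure[OF MN L K] tensor_assoc_pure[OF M N LK])
    then show "?f (?i t) = ?g (?i t)" by simp
  qed
  then show ?thesis by simp
qed


section \<open>Poisson algebras\<close>

lemma poisson_module: "poisson_algebra F P \<Longrightarrow> module F P"
  by (simp add: poisson_algebra_def algebra_def)

lemma poisson_cring: "poisson_algebra F P \<Longrightarrow> cring P"
  by (simp add: poisson_algebra_def algebra_def)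

lemma poisson_mult_bilinear:
  assumes P: "poisson_algebra F P"
  shows "bilinear_on F P P P (monoid.mult P)"
proof -
  interpret PR: cring P by (rule poisson_cring[OF P])
  interpret PM: module F P by (rule poisson_module[OF P])
  interpret P: poisson_algebra F P by (rule P)
  have "x \<otimes>\<^bsub>P\<^esub> (c \<odot>\<^bsub>P\<^esub> y) = c \<odot>\<^bsub>P\<^esub> (x \<otimes>\<^bsub>P\<^esub> y)"
    if "c \<in> carrier F" "x \<in> carrier P" "y \<in> carrier P" for c x y
    using P.smult_assoc2[of c y x] that PR.m_comm[of x y] PR.m_comm[of x "c \<odot>\<^bsub>P\<^esub> y"] by simp
  then show ?thesis
    unfolding bilinear_on_def by (simp add: PR.l_distr PR.r_distr P.smult_assoc2)
qed

lemma poisson_bracket_bilinear: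
  assumes "poisson_algebra F P"
  shows "bilinear_on F P P P (bracket P)"
  using assms unfolding bilinear_on_def poisson_algebra_def poisson_algebra_axioms_def by auto

lemmas poisson_bracket_linear =
  bspec[OF conjunct1[OF iffD1[OF bilinear_on_iff poisson_bracket_bilinear]]]
  bspec[OF conjunct2[OF iffD1[OF bilinear_on_iff poisson_bracket_bilinear]]]

lemmas poisson_mult_linear =
  bspec[OF conjunct1[OF iffD1[OF bilinear_on_iff poisson_mult_bilinear]]]
  bspec[OF conjunct2[OF iffD1[OF bilinear_on_iff poisson_mult_bilinear]]]

text \<open>
  Polarization of \<open>[x + y, x + y] = 0\<close>.
\<close>

lemma poisson_antisym:
  assumes P: "poisson_algebra F P" and x: "x \<in> carrier P" and y: "y \<in> carrier P"
  shows "bracket P x y \<oplus>\<^bsub>P\<^esub> bracket P y x = \<zero>\<^bsub>P\<^esub>"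
proof -
  interpret PR: cring P by (rule poisson_cring[OF P])
  interpret P: poisson_algebra F P by (rule P)
  have "bracket P (x \<oplus>\<^bsub>P\<^esub> y) (x \<oplus>\<^bsub>P\<^esub> y) = \<zero>\<^bsub>P\<^esub>"
    using x y by (simp add: P.bracket_alternating)
  then show ?thesis
    using x y
    by (simp add: P.bracket_add_left P.bracket_add_right P.bracket_closed
        P.bracket_alternating[OF x] P.bracket_alternating[OF y] PR.a_comm)
qed

text \<open>
  Leibniz for \<open>1 = 1 \<cdot> 1\<close> gives \<open>[x, 1] = [x, 1] + [x, 1]\<close>.
\<close>

lemma poisson_bracket_one:
  assumes P: "poisson_algebra F P" and x: "x \<in> carrier P"
  shows "bracket P x \<one>\<^bsub>P\<^esub> = \<zero>\<^bsub>P\<^esub>" "bracket P \<one>\<^bsub>P\<^esub> x = \<zero>\<^bsub>P\<^esub>"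
proof -
  interpret PR: cring P by (rule poisson_cring[OF P])
  interpret P: poisson_algebra F P by (rule P)
  have c: "bracket P x \<one>\<^bsub>P\<^esub> \<in> carrier P" "bracket P \<one>\<^bsub>P\<^esub> x \<in> carrier P"
    using x by (auto intro: P.bracket_closed)
  have "bracket P x (\<one>\<^bsub>P\<^esub> \<otimes>\<^bsub>P\<^esub> \<one>\<^bsub>P\<^esub>) = bracket P x \<one>\<^bsub>P\<^esub> \<oplus>\<^bsub>P\<^esub> bracket P x \<one>\<^bsub>P\<^esub>"
    using x c by (subst P.leibniz) auto
  then show 1: "bracket P x \<one>\<^bsub>P\<^esub> = \<zero>\<^bsub>P\<^esub>"
    using c by (simp add: PR.add.r_cancel_one')
  show "bracket P \<one>\<^bsub>P\<^esub> x = \<zero>\<^bsub>P\<^esub>"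
    using poisson_antisym[OF P x PR.one_closed] 1 c by simp
qed

lemma poisson_leibniz_left:
  assumes P: "poisson_algebra F P" and x: "x \<in> carrier P" and y: "y \<in> carrier P" and z: "z \<in> carrier P"
  shows "bracket P (x \<otimes>\<^bsub>P\<^esub> y) z = bracket P x z \<otimes>\<^bsub>P\<^esub> y \<oplus>\<^bsub>P\<^esub> x \<otimes>\<^bsub>P\<^esub> bracket P y z"
proof -
  interpret PR: cring P by (rule poisson_cring[OF P])
  interpret P: poisson_algebra F P by (rule P)
  have anti: "bracket P u v = \<ominus>\<^bsub>P\<^esub> bracket P v u" if "u \<in> carrier P" "v \<in> carrier P" for u v
    using poisson_antisym[OF P that] that by (simp add: PR.minus_equality P.bracket_closed)
  show ?thesis
    using x y z
    by (simp add: anti[of _ z] P.leibniz P.bracket_closed PR.minus_add PR.l_minus PR.r_minus)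
qed


section \<open>The tensor product of Poisson algebras\<close>

lemma tensor_poisson_simps [simp]:
  "carrier (tensor_poisson F P Q) = carrier (tensor_space F P Q)"
  "zero (tensor_poisson F P Q) = zero (tensor_space F P Q)"
  "add (tensor_poisson F P Q) = add (tensor_space F P Q)"
  "smult (tensor_poisson F P Q) = smult (tensor_space F P Q)"
  "\<one>\<^bsub>tensor_poisson F P Q\<^esub> = pure_tensor F P Q \<one>\<^bsub>P\<^esub> \<one>\<^bsub>Q\<^esub>"
  by (simp_all add: tensor_poisson_def Let_def)

text \<open>
  The tensor relation sees only the module structure.  Hence an iterated tensor product of Poisson
  algebras has the iterated tensor product of modules as its underlying module, and
  the rules \<open>tensor_poisson_as_space\<close> pass from one to the other.
\<close>

lemma tensor_rel_cong:
  assumes M: "carrier M' = carrier M" "zero M' = zero M" "add M' = add M" "smult M' = smult M"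
    and N: "carrier N' = carrier N" "add N' = add N" "smult N' = smult N"
  shows "tensor_rel F M' N' = tensor_rel F M N"
proof -
  note eqs = M N
  have "(xs, ys) \<in> tensor_rel F M N" if "(xs, ys) \<in> tensor_rel F M' N'" for xs ys
    using that by induction (auto simp: eqs intro: tensor_rel.intros)
  moreover have "(xs, ys) \<in> tensor_rel F M' N'" if "(xs, ys) \<in> tensor_rel F M N" for xs ys
    using that
  proof induction
    case (perm xs ys) then show ?case
      by (intro tensor_rel.perm) (simp_all add: eqs)
  next
    case (zero n) then show ?case using tensor_rel.zero[where N=N' and M=M' and F=F and n=n] by (simp add: eqs)
  next
    case (add_left m m' n) then show ?case using tensor_rel.add_left[where N=N' and M=M' and F=F and n=n and m=m and m'=m'] by (simp add: eqs)
  next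
    case (add_right m n n') then show ?case using tensor_rel.add_right[where N=N' and M=M' and F=F and n=n and m=m and n'=n'] by (simp add: eqs)
  next
    case (balanced c m n) then show ?case using tensor_rel.balanced[where N=N' and M=M' and F=F and n=n and m=m and c=c] by (simp add: eqs)
  qed (auto simp: eqs intro: tensor_rel.sym tensor_rel.trans tensor_rel.Cons)
  ultimately show ?thesis by auto
qed

lemma tensor_rel_poisson:
  "tensor_rel F (tensor_poisson F P Q) N = tensor_rel F (tensor_space F P Q) N"
  "tensor_rel F M (tensor_poisson F P Q) = tensor_rel F M (tensor_space F P Q)"
  by (rule tensor_rel_cong; simp)+

lemma tensor_space_poisson:
  "tensor_space F (tensor_poisson F P Q) N = tensor_space F (tensor_space F P Q) N"
  "tensor_space F M (tensor_poisson F P Q) = tensor_space F M (tensor_space F P Q)"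
  by (simp_all add: tensor_space_def tensor_class_def tensor_rel_poisson)

lemma pure_tensor_poisson:
  "pure_tensor F (tensor_poisson F P Q) N = pure_tensor F (tensor_space F P Q) N"
  "pure_tensor F M (tensor_poisson F P Q) = pure_tensor F M (tensor_space F P Q)"
  by (simp_all add: pure_tensor_def tensor_class_def tensor_rel_poisson fun_eq_iff)

lemma tensor_map_poisson:
  "tensor_map F (tensor_poisson F P Q) N = tensor_map F (tensor_space F P Q) N"
  "tensor_map F M (tensor_poisson F P Q) = tensor_map F M (tensor_space F P Q)"
  by (simp_all add: tensor_map_def tensor_space_poisson pure_tensor_poisson fun_eq_iff)

lemma linear_on_poisson:
  "linear_on F (tensor_poisson F P Q) = linear_on F (tensor_space F P Q)"
  "linear_on F M (tensor_poisson F P Q) = linear_on F M (tensor_space F P Q)"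
  by (simp_all add: linear_on_def fun_eq_iff)

lemmas tensor_poisson_as_space =
  tensor_space_poisson pure_tensor_poisson tensor_map_poisson linear_on_poisson

text \<open>
  The shape of the Jacobi sum of three pure tensors after expansion by the Leibniz rule: the \<open>x\<^sub>i\<close> and
  the \<open>y\<^sub>i\<close> are the terms with a double bracket in the right and in the left factor, and the mixed
  terms, one bracket in each factor, cancel in pairs by antisymmetry.
\<close>

lemma (in abelian_monoid) jacobi_cancel:
  assumes "{x1, x2, x3, y1, y2, y3, p, p', q, q', r, r', s, s', t, t', u, u'} \<subseteq> carrier G"
    and "x1 \<oplus> x2 \<oplus> x3 = \<zero>" "y1 \<oplus> y2 \<oplus> y3 = \<zero>"
    and "p \<oplus> p' = \<zero>" "q \<oplus> q' = \<zero>" "r \<oplus> r' = \<zero>" "s \<oplus> s' = \<zero>" "t \<oplus> t' = \<zero>" "u \<oplus> u' = \<zero>"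
  shows "(x1 \<oplus> (p \<oplus> q) \<oplus> ((r \<oplus> s) \<oplus> y1)) \<oplus> (x2 \<oplus> (t \<oplus> r') \<oplus> ((u \<oplus> p') \<oplus> y2))
    \<oplus> (x3 \<oplus> (s' \<oplus> u') \<oplus> ((q' \<oplus> t') \<oplus> y3)) = \<zero>"
proof -
  have "(x1 \<oplus> (p \<oplus> q) \<oplus> ((r \<oplus> s) \<oplus> y1)) \<oplus> (x2 \<oplus> (t \<oplus> r') \<oplus> ((u \<oplus> p') \<oplus> y2))
    \<oplus> (x3 \<oplus> (s' \<oplus> u') \<oplus> ((q' \<oplus> t') \<oplus> y3))
    = (x1 \<oplus> x2 \<oplus> x3) \<oplus> (y1 \<oplus> y2 \<oplus> y3) \<oplus> (p \<oplus> p') \<oplus> (q \<oplus> q') \<oplus> (r \<oplus> r') \<oplus> (s \<oplus> s')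
      \<oplus> (t \<oplus> t') \<oplus> (u \<oplus> u')"
    using assms(1) by (simp only: insert_subset a_ac a_closed)
  then show ?thesis by (simp add: assms(2-))
qed

context
  fixes F :: "('f, 'k) ring_scheme" and P :: "('f, 'p, 'x) poisson_scheme"
    and Q :: "('f, 'q, 'y) poisson_scheme"
  assumes P: "poisson_algebra F P" and Q: "poisson_algebra F Q"
begin

interpretation PR: cring P by (rule poisson_cring[OF P])
interpretation QR: cring Q by (rule poisson_cring[OF Q])
interpretation P: poisson_algebra F P by (rule P)
interpretation Q: poisson_algebra F Q by (rule Q)
interpretation T: module F "tensor_space F P Q"
  by (rule tensor_space_module[OF poisson_module[OF P] poisson_module[OF Q]])

private abbreviation (input) "TP \<equiv> tensor_poisson F P Q"
private abbreviation (input) "TS \<equiv> tensor_space F P Q"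
private abbreviation (input) "pt \<equiv> pure_tensor F P Q"

private lemmas pm = poisson_module[OF P] poisson_module[OF Q]
private lemmas pt_simps = pure_tensor_simps[OF pm]
private lemmas tp_induct = tensor_induct[OF pm, consumes 1, case_names pure add]

lemma tensor_mult:
  shows tensor_mult_bilinear: "bilinear_on F TS TS TS (monoid.mult TP)"
    and tensor_mult_pure: "\<And>p q r s. p \<in> carrier P \<Longrightarrow> q \<in> carrier Q \<Longrightarrow> r \<in> carrier P \<Longrightarrow> s \<in> carrier Q \<Longrightarrow>
      pt p q \<otimes>\<^bsub>TP\<^esub> pt r s = pt (p \<otimes>\<^bsub>P\<^esub> r) (q \<otimes>\<^bsub>Q\<^esub> s)"
proof -
  have "bilinear_on F P Q TS (\<lambda>r s. pt (p \<otimes>\<^bsub>P\<^esub> r) (q \<otimes>\<^bsub>Q\<^esub> s))"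
    "bilinear_on F P Q TS (\<lambda>r s. pt (r \<otimes>\<^bsub>P\<^esub> p) (s \<otimes>\<^bsub>Q\<^esub> q))"
    if "p \<in> carrier P" "q \<in> carrier Q" for p q
    using that unfolding bilinear_on_def
    by (simp_all add: pt_simps linear_onD[OF poisson_mult_linear(1)[OF P]]
        linear_onD[OF poisson_mult_linear(2)[OF P]]
        linear_onD[OF poisson_mult_linear(1)[OF Q]] linear_onD[OF poisson_mult_linear(2)[OF Q]])
  note * = tensor_lift2[OF pm pm T.module_axioms this]
  show "bilinear_on F TS TS TS (monoid.mult TP)"
    unfolding tensor_poisson_def Let_def by (simp add: *(1))
  show "pt p q \<otimes>\<^bsub>TP\<^esub> pt r s = pt (p \<otimes>\<^bsub>P\<^esub> r) (q \<otimes>\<^bsub>Q\<^esub> s)"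
    if "p \<in> carrier P" "q \<in> carrier Q" "r \<in> carrier P" "s \<in> carrier Q" for p q r s
    using that unfolding tensor_poisson_def Let_def by (simp add: *(2))
qed

lemma tensor_bracket:
  shows tensor_bracket_bilinear: "bilinear_on F TS TS TS (bracket TP)"
    and tensor_bracket_pure: "\<And>p q r s. p \<in> carrier P \<Longrightarrow> q \<in> carrier Q \<Longrightarrow> r \<in> carrier P \<Longrightarrow> s \<in> carrier Q \<Longrightarrow>
      bracket TP (pt p q) (pt r s) =
        pt (p \<otimes>\<^bsub>P\<^esub> r) (bracket Q q s) \<oplus>\<^bsub>TS\<^esub> pt (bracket P p r) (q \<otimes>\<^bsub>Q\<^esub> s)"
proof -
  have "bilinear_on F P Q TS (\<lambda>r s. pt (p \<otimes>\<^bsub>P\<^esub> r) (bracket Q q s) \<oplus>\<^bsub>TS\<^esub> pt (bracket P p r) (q \<otimes>\<^bsub>Q\<^esub> s))"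
    "bilinear_on F P Q TS (\<lambda>r s. pt (r \<otimes>\<^bsub>P\<^esub> p) (bracket Q s q) \<oplus>\<^bsub>TS\<^esub> pt (bracket P r p) (s \<otimes>\<^bsub>Q\<^esub> q))"
    if "p \<in> carrier P" "q \<in> carrier Q" for p q
    using that unfolding bilinear_on_def
    by (simp_all add: pt_simps T.smult_r_distr T.M.a_ac linear_onD[OF poisson_mult_linear(1)[OF P]]
        linear_onD[OF poisson_mult_linear(2)[OF P]]
        linear_onD[OF poisson_mult_linear(1)[OF Q]] linear_onD[OF poisson_mult_linear(2)[OF Q]]
        linear_onD[OF poisson_bracket_linear(1)[OF P]] linear_onD[OF poisson_bracket_linear(2)[OF P]]
        linear_onD[OF poisson_bracket_linear(1)[OF Q]] linear_onD[OF poisson_bracket_linear(2)[OF Q]])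
  note * = tensor_lift2[OF pm pm T.module_axioms this]
  show "bilinear_on F TS TS TS (bracket TP)"
    unfolding tensor_poisson_def Let_def by (simp add: *(1))
  show "bracket TP (pt p q) (pt r s) =
        pt (p \<otimes>\<^bsub>P\<^esub> r) (bracket Q q s) \<oplus>\<^bsub>TS\<^esub> pt (bracket P p r) (q \<otimes>\<^bsub>Q\<^esub> s)"
    if "p \<in> carrier P" "q \<in> carrier Q" "r \<in> carrier P" "s \<in> carrier Q" for p q r s
    using that unfolding tensor_poisson_def Let_def by (simp add: *(2))
qed

lemmas tensor_mult_simps =
  linear_onD(1,2,3)[OF bspec[OF conjunct1[OF iffD1[OF bilinear_on_iff tensor_mult_bilinear]]]]
  linear_onD(2,3)[OF bspec[OF conjunct2[OF iffD1[OF bilinear_on_iff tensor_mult_bilinear]]]]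

lemmas tensor_bracket_simps =
  linear_onD(1,2,3)[OF bspec[OF conjunct1[OF iffD1[OF bilinear_on_iff tensor_bracket_bilinear]]]]
  linear_onD(2,3)[OF bspec[OF conjunct2[OF iffD1[OF bilinear_on_iff tensor_bracket_bilinear]]]]

lemma tensor_poisson_module: "module F TP"
proof (rule moduleI)
  show "abelian_group TP"
    by (rule abelian_groupI) (auto simp: T.M.a_ac intro: T.M.l_neg)
qed (auto simp: T.smult_l_distr T.smult_r_distr T.smult_assoc1 intro: module.axioms(1)[OF poisson_module[OF P]])

lemma tensor_mult_assoc:
  assumes A: "A \<in> carrier TS" and B: "B \<in> carrier TS" and C: "C \<in> carrier TS"
  shows "(A \<otimes>\<^bsub>TP\<^esub> B) \<otimes>\<^bsub>TP\<^esub> C = A \<otimes>\<^bsub>TP\<^esub> (B \<otimes>\<^bsub>TP\<^esub> C)"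
  using A
proof (induction rule: tp_induct)
  case (pure p q)
  note A = pure
  show ?case using B
  proof (induction rule: tp_induct)
    case (pure r s)
    note B = pure
    show ?case using C
      by (induction rule: tp_induct)
        (use A B in \<open>simp_all add: tensor_mult_pure tensor_mult_simps pt_simps PR.m_assoc QR.m_assoc\<close>)
  qed (use A C in \<open>simp_all add: tensor_mult_simps pt_simps\<close>)
qed (use B C in \<open>simp_all add: tensor_mult_simps\<close>)

lemma tensor_mult_comm:
  assumes A: "A \<in> carrier TS" and B: "B \<in> carrier TS"
  shows "A \<otimes>\<^bsub>TP\<^esub> B = B \<otimes>\<^bsub>TP\<^esub> A"
  using A
proof (induction rule: tp_induct)
  case (pure p q)
  note A = pure
  show ?case using B
    by (induction rule: tp_induct)
      (use A in \<open>simp_all add: tensor_mult_pure tensor_mult_simps pt_simps PR.m_comm QR.m_comm\<close>)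
qed (use B in \<open>simp_all add: tensor_mult_simps\<close>)

lemma tensor_mult_one:
  assumes A: "A \<in> carrier TS"
  shows "pt \<one>\<^bsub>P\<^esub> \<one>\<^bsub>Q\<^esub> \<otimes>\<^bsub>TP\<^esub> A = A"
  using A
  by (induction rule: tp_induct) (simp_all add: tensor_mult_pure tensor_mult_simps pt_simps)

lemma tensor_poisson_cring: "cring TP"
proof -
  interpret TM: module F TP by (rule tensor_poisson_module)
  show ?thesis
  proof (rule cringI)
    show "comm_monoid TP"
    proof (rule comm_monoidI)
      show "A \<otimes>\<^bsub>TP\<^esub> B = B \<otimes>\<^bsub>TP\<^esub> A" if "A \<in> carrier TP" "B \<in> carrier TP" for A B
        using that by (simp add: tensor_mult_comm[of A B])
    qed (simp_all add: tensor_mult_assoc tensor_mult_one tensor_mult_simps pt_simps)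
  qed (auto simp: tensor_mult_simps intro: TM.abelian_group_axioms)
qed

text \<open>
  Antisymmetry has to come before alternation, because \<open>A \<mapsto> [A, A]\<close> is not additive: its
  failure to be so is \<open>[A, B] + [B, A]\<close>.
\<close>

lemma tensor_bracket_antisym:
  assumes A: "A \<in> carrier TS" and B: "B \<in> carrier TS"
  shows "bracket TP A B \<oplus>\<^bsub>TS\<^esub> bracket TP B A = \<zero>\<^bsub>TS\<^esub>"
  using A
proof (induction rule: tp_induct)
  case (pure p q)
  note A = pure
  show ?case using B
  proof (induction rule: tp_induct)
    case (pure r s)
    have "bracket TP (pt p q) (pt r s) \<oplus>\<^bsub>TS\<^esub> bracket TP (pt r s) (pt p q)
        = (pt (p \<otimes>\<^bsub>P\<^esub> r) (bracket Q q s) \<oplus>\<^bsub>TS\<^esub> pt (p \<otimes>\<^bsub>P\<^esub> r) (bracket Q s q))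
          \<oplus>\<^bsub>TS\<^esub> (pt (bracket P p r) (q \<otimes>\<^bsub>Q\<^esub> s) \<oplus>\<^bsub>TS\<^esub> pt (bracket P r p) (q \<otimes>\<^bsub>Q\<^esub> s))"
      using A pure
      by (simp add: tensor_bracket_pure pt_simps P.bracket_closed Q.bracket_closed
          PR.m_comm[of r p] QR.m_comm[of s q] T.M.a_ac)
    also have "\<dots> = pt (p \<otimes>\<^bsub>P\<^esub> r) (bracket Q q s \<oplus>\<^bsub>Q\<^esub> bracket Q s q)
          \<oplus>\<^bsub>TS\<^esub> pt (bracket P p r \<oplus>\<^bsub>P\<^esub> bracket P r p) (q \<otimes>\<^bsub>Q\<^esub> s)"
      using A pure by (simp add: pt_simps P.bracket_closed Q.bracket_closed)
    also have "\<dots> = \<zero>\<^bsub>TS\<^esub>"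
      using A pure by (simp add: poisson_antisym[OF P] poisson_antisym[OF Q] pt_simps)
    finally show ?case .
  next
    case (add B B')
    have "bracket TP (pt p q) (B \<oplus>\<^bsub>TS\<^esub> B') \<oplus>\<^bsub>TS\<^esub> bracket TP (B \<oplus>\<^bsub>TS\<^esub> B') (pt p q)
      = (bracket TP (pt p q) B \<oplus>\<^bsub>TS\<^esub> bracket TP B (pt p q))
        \<oplus>\<^bsub>TS\<^esub> (bracket TP (pt p q) B' \<oplus>\<^bsub>TS\<^esub> bracket TP B' (pt p q))"
      using add.hyps A by (simp add: tensor_bracket_simps pt_simps T.M.a_ac)
    then show ?case by (simp add: add.IH)
  qed
next
  case (add A A')
  have "bracket TP (A \<oplus>\<^bsub>TS\<^esub> A') B \<oplus>\<^bsub>TS\<^esub> bracket TP B (A \<oplus>\<^bsub>TS\<^esub> A')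
    = (bracket TP A B \<oplus>\<^bsub>TS\<^esub> bracket TP B A) \<oplus>\<^bsub>TS\<^esub> (bracket TP A' B \<oplus>\<^bsub>TS\<^esub> bracket TP B A')"
    using add.hyps B by (simp add: tensor_bracket_simps T.M.a_ac)
  then show ?case by (simp add: add.IH)
qed

lemma tensor_bracket_alternating:
  assumes A: "A \<in> carrier TS"
  shows "bracket TP A A = \<zero>\<^bsub>TS\<^esub>"
  using A
proof (induction rule: tp_induct)
  case (pure p q)
  then show ?case
    by (simp add: tensor_bracket_pure P.bracket_alternating Q.bracket_alternating pt_simps)
next
  case (add A B)
  have "bracket TP (A \<oplus>\<^bsub>TS\<^esub> B) (A \<oplus>\<^bsub>TS\<^esub> B)
    = bracket TP A A \<oplus>\<^bsub>TS\<^esub> bracket TP B B \<oplus>\<^bsub>TS\<^esub> (bracket TP A B \<oplus>\<^bsub>TS\<^esub> bracket TP B A)"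
    using add.hyps by (simp add: tensor_bracket_simps T.M.a_ac)
  then show ?case by (simp add: add tensor_bracket_antisym)
qed

lemma tensor_leibniz:
  assumes A: "A \<in> carrier TS" and B: "B \<in> carrier TS" and C: "C \<in> carrier TS"
  shows "bracket TP A (B \<otimes>\<^bsub>TP\<^esub> C) = bracket TP A B \<otimes>\<^bsub>TP\<^esub> C \<oplus>\<^bsub>TS\<^esub> B \<otimes>\<^bsub>TP\<^esub> bracket TP A C"
  using A
proof (induction rule: tp_induct)
  case (pure p q)
  note A = pure
  show ?case using B
  proof (induction rule: tp_induct)
    case (pure r s)
    note B = pure
    show ?case using C
    proof (induction rule: tp_induct)
      case (pure v w)
      with A B show ?case
        by (simp add: tensor_mult_pure tensor_bracket_pure tensor_mult_simps pt_simps
            P.bracket_closed Q.bracket_closed P.leibniz Q.leibniz PR.m_ac QR.m_ac T.M.a_ac)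
    qed (use A B in \<open>simp_all add: tensor_mult_simps tensor_bracket_simps pt_simps T.M.a_ac\<close>)
  qed (use A C in \<open>simp_all add: tensor_mult_simps tensor_bracket_simps pt_simps T.M.a_ac\<close>)
qed (use B C in \<open>simp_all add: tensor_mult_simps tensor_bracket_simps T.M.a_ac\<close>)

lemma tensor_jacobi_pure:
  assumes a: "a \<in> carrier P" "a' \<in> carrier Q" and b: "b \<in> carrier P" "b' \<in> carrier Q"
    and c: "c \<in> carrier P" "c' \<in> carrier Q"
  shows "bracket TP (pt a a') (bracket TP (pt b b') (pt c c'))
    \<oplus>\<^bsub>TS\<^esub> bracket TP (pt b b') (bracket TP (pt c c') (pt a a'))
    \<oplus>\<^bsub>TS\<^esub> bracket TP (pt c c') (bracket TP (pt a a') (pt b b')) = \<zero>\<^bsub>TS\<^esub>"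
proof -
  note cl = P.bracket_closed Q.bracket_closed pt_simps(1)
  \<comment> \<open>Leibniz in each factor splits each of the two mixed terms in two.\<close>
  have exp: "bracket TP (pt x x') (bracket TP (pt y y') (pt z z'))
    = pt (x \<otimes>\<^bsub>P\<^esub> (y \<otimes>\<^bsub>P\<^esub> z)) (bracket Q x' (bracket Q y' z'))
      \<oplus>\<^bsub>TS\<^esub> (pt (y \<otimes>\<^bsub>P\<^esub> bracket P x z) (x' \<otimes>\<^bsub>Q\<^esub> bracket Q y' z')
        \<oplus>\<^bsub>TS\<^esub> pt (z \<otimes>\<^bsub>P\<^esub> bracket P x y) (x' \<otimes>\<^bsub>Q\<^esub> bracket Q y' z'))
      \<oplus>\<^bsub>TS\<^esub> ((pt (x \<otimes>\<^bsub>P\<^esub> bracket P y z) (y' \<otimes>\<^bsub>Q\<^esub> bracket Q x' z')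
        \<oplus>\<^bsub>TS\<^esub> pt (x \<otimes>\<^bsub>P\<^esub> bracket P y z) (z' \<otimes>\<^bsub>Q\<^esub> bracket Q x' y'))
      \<oplus>\<^bsub>TS\<^esub> pt (bracket P x (bracket P y z)) (x' \<otimes>\<^bsub>Q\<^esub> (y' \<otimes>\<^bsub>Q\<^esub> z')))"
    if "x \<in> carrier P" "x' \<in> carrier Q" "y \<in> carrier P" "y' \<in> carrier Q" "z \<in> carrier P" "z' \<in> carrier Q"
    for x x' y y' z z'
    using that
    by (simp add: tensor_bracket_pure tensor_bracket_simps pt_simps cl P.leibniz Q.leibniz
        PR.m_comm[of "bracket P x y" z] QR.m_comm[of "bracket Q x' y'" z'] T.M.a_ac)
  have sumP: "pt (m \<otimes>\<^bsub>P\<^esub> bracket P x y) n \<oplus>\<^bsub>TS\<^esub> pt (m \<otimes>\<^bsub>P\<^esub> bracket P y x) n = \<zero>\<^bsub>TS\<^esub>"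
    if "m \<in> carrier P" "n \<in> carrier Q" "x \<in> carrier P" "y \<in> carrier P" for m n x y
  proof -
    have "pt (m \<otimes>\<^bsub>P\<^esub> bracket P x y) n \<oplus>\<^bsub>TS\<^esub> pt (m \<otimes>\<^bsub>P\<^esub> bracket P y x) n
      = pt (m \<otimes>\<^bsub>P\<^esub> (bracket P x y \<oplus>\<^bsub>P\<^esub> bracket P y x)) n"
      using that by (simp add: pt_simps cl PR.r_distr)
    then show ?thesis using that by (simp add: poisson_antisym[OF P] pt_simps)
  qed
  have sumQ: "pt m (n \<otimes>\<^bsub>Q\<^esub> bracket Q x y) \<oplus>\<^bsub>TS\<^esub> pt m (n \<otimes>\<^bsub>Q\<^esub> bracket Q y x) = \<zero>\<^bsub>TS\<^esub>"
    if "m \<in> carrier P" "n \<in> carrier Q" "x \<in> carrier Q" "y \<in> carrier Q" for m n x y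
  proof -
    have "pt m (n \<otimes>\<^bsub>Q\<^esub> bracket Q x y) \<oplus>\<^bsub>TS\<^esub> pt m (n \<otimes>\<^bsub>Q\<^esub> bracket Q y x)
      = pt m (n \<otimes>\<^bsub>Q\<^esub> (bracket Q x y \<oplus>\<^bsub>Q\<^esub> bracket Q y x))"
      using that by (simp add: pt_simps cl QR.r_distr)
    then show ?thesis using that by (simp add: poisson_antisym[OF Q] pt_simps)
  qed
  \<comment> \<open>Under cyclic rotation the products of three elements stay the same.\<close>
  have abc: "b \<otimes>\<^bsub>P\<^esub> (c \<otimes>\<^bsub>P\<^esub> a) = a \<otimes>\<^bsub>P\<^esub> (b \<otimes>\<^bsub>P\<^esub> c)" "c \<otimes>\<^bsub>P\<^esub> (a \<otimes>\<^bsub>P\<^esub> b) = a \<otimes>\<^bsub>P\<^esub> (b \<otimes>\<^bsub>P\<^esub> c)"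
    "b' \<otimes>\<^bsub>Q\<^esub> (c' \<otimes>\<^bsub>Q\<^esub> a') = a' \<otimes>\<^bsub>Q\<^esub> (b' \<otimes>\<^bsub>Q\<^esub> c')" "c' \<otimes>\<^bsub>Q\<^esub> (a' \<otimes>\<^bsub>Q\<^esub> b') = a' \<otimes>\<^bsub>Q\<^esub> (b' \<otimes>\<^bsub>Q\<^esub> c')"
    using a b c by (simp_all add: PR.m_ac QR.m_ac)
  have X: "pt m x \<oplus>\<^bsub>TS\<^esub> pt m y \<oplus>\<^bsub>TS\<^esub> pt m z = pt m (x \<oplus>\<^bsub>Q\<^esub> y \<oplus>\<^bsub>Q\<^esub> z)"
    if "m \<in> carrier P" "x \<in> carrier Q" "y \<in> carrier Q" "z \<in> carrier Q" for m x y z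
    using that by (simp add: pt_simps)
  have Y: "pt x m \<oplus>\<^bsub>TS\<^esub> pt y m \<oplus>\<^bsub>TS\<^esub> pt z m = pt (x \<oplus>\<^bsub>P\<^esub> y \<oplus>\<^bsub>P\<^esub> z) m"
    if "m \<in> carrier Q" "x \<in> carrier P" "y \<in> carrier P" "z \<in> carrier P" for m x y z
    using that by (simp add: pt_simps)
  show ?thesis
    unfolding exp[OF a b c] exp[OF b c a] exp[OF c a b] abc
  proof (rule T.M.jacobi_cancel)
  qed (use a b c in \<open>simp_all add: cl X Y P.jacobi Q.jacobi sumP sumQ pt_simps(6,7)
       del: PR.r_distr PR.l_distr QR.r_distr QR.l_distr\<close>)
qed

lemma tensor_jacobi:
  assumes A: "A \<in> carrier TS" and B: "B \<in> carrier TS" and C: "C \<in> carrier TS"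
  shows "bracket TP A (bracket TP B C) \<oplus>\<^bsub>TS\<^esub> bracket TP B (bracket TP C A)
    \<oplus>\<^bsub>TS\<^esub> bracket TP C (bracket TP A B) = \<zero>\<^bsub>TS\<^esub>"
proof -
  have sum: "(x \<oplus>\<^bsub>TS\<^esub> x') \<oplus>\<^bsub>TS\<^esub> (y \<oplus>\<^bsub>TS\<^esub> y') \<oplus>\<^bsub>TS\<^esub> (z \<oplus>\<^bsub>TS\<^esub> z') = \<zero>\<^bsub>TS\<^esub>"
    if "x \<in> carrier TS" "x' \<in> carrier TS" "y \<in> carrier TS" "y' \<in> carrier TS"
      "z \<in> carrier TS" "z' \<in> carrier TS"
      "x \<oplus>\<^bsub>TS\<^esub> y \<oplus>\<^bsub>TS\<^esub> z = \<zero>\<^bsub>TS\<^esub>" "x' \<oplus>\<^bsub>TS\<^esub> y' \<oplus>\<^bsub>TS\<^esub> z' = \<zero>\<^bsub>TS\<^esub>" for x x' y y' z z'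
  proof -
    have "(x \<oplus>\<^bsub>TS\<^esub> x') \<oplus>\<^bsub>TS\<^esub> (y \<oplus>\<^bsub>TS\<^esub> y') \<oplus>\<^bsub>TS\<^esub> (z \<oplus>\<^bsub>TS\<^esub> z')
      = (x \<oplus>\<^bsub>TS\<^esub> y \<oplus>\<^bsub>TS\<^esub> z) \<oplus>\<^bsub>TS\<^esub> (x' \<oplus>\<^bsub>TS\<^esub> y' \<oplus>\<^bsub>TS\<^esub> z')"
      using that(1-6) by (simp add: T.M.a_ac)
    then show ?thesis by (simp add: that(7,8))
  qed
  show ?thesis
    using A
  proof (induction rule: tp_induct)
    case (pure p q)
    note A = pure
    show ?case using B
    proof (induction rule: tp_induct)
      case (pure r s)
      note B = pure
      show ?case using C
        by (induction rule: tp_induct)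
          (use A B in \<open>simp_all add: tensor_jacobi_pure tensor_bracket_simps pt_simps sum\<close>)
    qed (use A C in \<open>simp_all add: tensor_bracket_simps pt_simps sum\<close>)
  qed (use B C in \<open>simp_all add: tensor_bracket_simps sum\<close>)
qed

theorem tensor_poisson_algebra: "poisson_algebra F TP"
proof -
  interpret TR: cring TP by (rule tensor_poisson_cring)
  interpret TM: module F TP by (rule tensor_poisson_module)
  have "algebra F TP"
    by (rule algebra.intro[OF TM.module_axioms TR.cring_axioms])
      (auto simp: algebra_axioms_def tensor_mult_simps)
  then show ?thesis
    by (intro poisson_algebra.intro P.field_axioms poisson_algebra_axioms.intro)
      (simp_all add: tensor_bracket_simps tensor_bracket_alternating tensor_jacobi tensor_leibniz)
qed

end


section \<open>Morphisms of Poisson algebras\<close>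

lemma poisson_homI:
  assumes "linear_on F P Q h" and "h \<one>\<^bsub>P\<^esub> = \<one>\<^bsub>Q\<^esub>"
    and "\<And>x y. x \<in> carrier P \<Longrightarrow> y \<in> carrier P \<Longrightarrow> h (x \<otimes>\<^bsub>P\<^esub> y) = h x \<otimes>\<^bsub>Q\<^esub> h y"
    and "\<And>x y. x \<in> carrier P \<Longrightarrow> y \<in> carrier P \<Longrightarrow> h (bracket P x y) = bracket Q (h x) (h y)"
  shows "h \<in> poisson_hom F P Q"
  using assms unfolding poisson_hom_def linear_on_def by (auto intro!: ring_hom_memI)

lemma poisson_homD:
  assumes "h \<in> poisson_hom F P Q"
  shows "linear_on F P Q h" and "h \<one>\<^bsub>P\<^esub> = \<one>\<^bsub>Q\<^esub>"
    and "x \<in> carrier P \<Longrightarrow> h x \<in> carrier Q"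
    and "x \<in> carrier P \<Longrightarrow> y \<in> carrier P \<Longrightarrow> h (x \<oplus>\<^bsub>P\<^esub> y) = h x \<oplus>\<^bsub>Q\<^esub> h y"
    and "c \<in> carrier F \<Longrightarrow> x \<in> carrier P \<Longrightarrow> h (c \<odot>\<^bsub>P\<^esub> x) = c \<odot>\<^bsub>Q\<^esub> h x"
    and "x \<in> carrier P \<Longrightarrow> y \<in> carrier P \<Longrightarrow> h (x \<otimes>\<^bsub>P\<^esub> y) = h x \<otimes>\<^bsub>Q\<^esub> h y"
    and "x \<in> carrier P \<Longrightarrow> y \<in> carrier P \<Longrightarrow> h (bracket P x y) = bracket Q (h x) (h y)"
  using assms unfolding poisson_hom_def linear_on_def ring_hom_def by auto

lemma poisson_hom_id: "id \<in> poisson_hom F P P"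
  by (rule poisson_homI) (auto intro: linear_on_id)

lemma poisson_hom_comp:
  assumes f: "f \<in> poisson_hom F P Q" and g: "g \<in> poisson_hom F Q R"
  shows "g \<circ> f \<in> poisson_hom F P R"
  by (rule poisson_homI)
    (simp_all add: poisson_homD(2-)[OF f] poisson_homD(2-)[OF g]
      linear_on_comp[OF poisson_homD(1)[OF f] poisson_homD(1)[OF g]])

lemma base_poisson_simps [simp]:
  "carrier (base_poisson F) = carrier F" "\<one>\<^bsub>base_poisson F\<^esub> = \<one>\<^bsub>F\<^esub>"
  "zero (base_poisson F) = zero F" "add (base_poisson F) = add F"
  "smult (base_poisson F) = monoid.mult F" "monoid.mult (base_poisson F) = monoid.mult F"
  "bracket (base_poisson F) = (\<lambda>_ _. \<zero>\<^bsub>F\<^esub>)"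
  by (simp_all add: base_poisson_def)

lemma base_poisson_algebra:
  assumes "field F"
  shows "poisson_algebra F (base_poisson F)"
proof -
  interpret F: field F by fact
  let ?B = "base_poisson F"
  have "cring ?B"
  proof (rule cringI)
    show "abelian_group ?B"
      by (rule abelian_groupI) (auto simp: F.a_ac intro: F.l_neg)
    show "comm_monoid ?B"
      by (rule comm_monoidI) (auto simp: F.m_ac)
  qed (auto simp: F.l_distr)
  then have "algebra F ?B"
    by (intro algebraI F.cring_axioms) (auto simp: F.l_distr F.r_distr F.m_assoc)
  then show ?thesis
    by (intro poisson_algebra.intro poisson_algebra_axioms.intro assms) simp_all
qed

context
  fixes F :: "('f, 'k) ring_scheme" and P :: "('f, 'p, 'x) poisson_scheme"
    and Q :: "('f, 'q, 'y) poisson_scheme"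
  assumes P: "poisson_algebra F P" and Q: "poisson_algebra F Q"
begin

interpretation PR: cring P by (rule poisson_cring[OF P])
interpretation QR: cring Q by (rule poisson_cring[OF Q])
interpretation PM: module F P by (rule poisson_module[OF P])
interpretation QM: module F Q by (rule poisson_module[OF Q])
interpretation P: poisson_algebra F P by (rule P)
interpretation Q: poisson_algebra F Q by (rule Q)
interpretation T: module F "tensor_space F P Q"
  by (rule tensor_space_module[OF poisson_module[OF P] poisson_module[OF Q]])

private lemmas pt_simps' = pure_tensor_simps[OF poisson_module[OF P] poisson_module[OF Q]]

lemma tensor_inl_hom: "(\<lambda>p. pure_tensor F P Q p \<one>\<^bsub>Q\<^esub>) \<in> poisson_hom F P (tensor_poisson F P Q)"
  by (rule poisson_homI)
    (auto intro!: linear_onI simp: pt_simps' tensor_mult_pure[OF P Q] tensor_bracket_pure[OF P Q]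
      Q.bracket_alternating P.bracket_closed)

lemma tensor_inr_hom: "(\<lambda>q. pure_tensor F P Q \<one>\<^bsub>P\<^esub> q) \<in> poisson_hom F Q (tensor_poisson F P Q)"
  by (rule poisson_homI)
    (auto intro!: linear_onI simp: pt_simps' tensor_mult_pure[OF P Q] tensor_bracket_pure[OF P Q]
      P.bracket_alternating Q.bracket_closed)

lemma tensor_inl_inr_commute:
  assumes "p \<in> carrier P" "q \<in> carrier Q"
  shows "bracket (tensor_poisson F P Q) (pure_tensor F P Q p \<one>\<^bsub>Q\<^esub>) (pure_tensor F P Q \<one>\<^bsub>P\<^esub> q)
    = \<zero>\<^bsub>tensor_space F P Q\<^esub>"
  using assms
  by (simp add: tensor_bracket_pure[OF P Q] poisson_bracket_one[OF P] poisson_bracket_one[OF Q] pt_simps')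

lemma tensor_inl_inr_mult:
  assumes "p \<in> carrier P" "q \<in> carrier Q"
  shows "pure_tensor F P Q p \<one>\<^bsub>Q\<^esub> \<otimes>\<^bsub>tensor_poisson F P Q\<^esub> pure_tensor F P Q \<one>\<^bsub>P\<^esub> q = pure_tensor F P Q p q"
  using assms by (simp add: tensor_mult_pure[OF P Q])

text \<open>
  The universal property of the tensor product of Poisson algebras: two morphisms \<open>i\<close> and \<open>j\<close> whose
  images commute for the bracket combine to the morphism \<open>p \<otimes> q \<mapsto> i(p) j(q)\<close>.  On pure tensors
  the bracket is preserved because Leibniz expands \<open>[i(p) j(q), i(r) j(s)]\<close> into four terms, of which
  those with a bracket of some \<open>i\<close> with some \<open>j\<close> vanish.  All the structure maps below
  (tensor products of morphisms, the associator, the unit isomorphisms) are recognized as morphisms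
  in this way.
\<close>

lemma poisson_hom_from_tensor:
  fixes W :: "('f, 'w, 'z) poisson_scheme"
  assumes W: "poisson_algebra F W"
    and h: "linear_on F (tensor_space F P Q) W h"
    and i: "i \<in> poisson_hom F P W" and j: "j \<in> poisson_hom F Q W"
    and comm: "\<And>p q. p \<in> carrier P \<Longrightarrow> q \<in> carrier Q \<Longrightarrow> bracket W (i p) (j q) = \<zero>\<^bsub>W\<^esub>"
    and hp: "\<And>p q. p \<in> carrier P \<Longrightarrow> q \<in> carrier Q \<Longrightarrow> h (pure_tensor F P Q p q) = i p \<otimes>\<^bsub>W\<^esub> j q"
  shows "h \<in> poisson_hom F (tensor_poisson F P Q) W"
proof -
  interpret WR: cring W by (rule poisson_cring[OF W])
  interpret W: poisson_algebra F W by (rule W)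
  note pm = poisson_module[OF P] poisson_module[OF Q]
  note tp_induct = tensor_induct[OF pm, consumes 1, case_names pure add]
  note i' = poisson_homD(2-)[OF i] and j' = poisson_homD(2-)[OF j] and h' = linear_onD[OF h]
  note mult_simps = tensor_mult_simps[OF P Q] and bracket_simps = tensor_bracket_simps[OF P Q]
  note cl = P.bracket_closed Q.bracket_closed W.bracket_closed
  have comm': "bracket W (j q) (i p) = \<zero>\<^bsub>W\<^esub>" if "p \<in> carrier P" "q \<in> carrier Q" for p q
    using poisson_antisym[OF W i'(2)[OF that(1)] j'(2)[OF that(2)]] that
    by (simp add: comm i' j' cl)
  have mult: "h (A \<otimes>\<^bsub>tensor_poisson F P Q\<^esub> B) = h A \<otimes>\<^bsub>W\<^esub> h B"
    if A: "A \<in> carrier (tensor_space F P Q)" and B: "B \<in> carrier (tensor_space F P Q)" for A B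
    using A
  proof (induction rule: tp_induct)
    case (pure p q)
    note A = pure
    show ?case using B
    proof (induction rule: tp_induct)
      case (pure r s)
      then show ?case using A by (simp add: tensor_mult_pure[OF P Q] hp i' j' WR.m_ac)
    qed (use A in \<open>simp_all add: mult_simps pt_simps' h' WR.r_distr\<close>)
  qed (use B in \<open>simp_all add: mult_simps h' WR.l_distr\<close>)
  have brack: "h (bracket (tensor_poisson F P Q) A B) = bracket W (h A) (h B)"
    if A: "A \<in> carrier (tensor_space F P Q)" and B: "B \<in> carrier (tensor_space F P Q)" for A B
    using A
  proof (induction rule: tp_induct)
    case (pure p q)
    note A = pure
    show ?case using B
    proof (induction rule: tp_induct)
      case (pure r s)
      then show ?case
        using A by (simp add: tensor_bracket_pure[OF P Q] hp i' j' h' pt_simps' cl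
            W.leibniz poisson_leibniz_left[OF W] comm comm' WR.m_ac WR.a_ac)
    qed (use A in \<open>simp_all add: bracket_simps pt_simps' h' W.bracket_add_right\<close>)
  qed (use B in \<open>simp_all add: bracket_simps h' W.bracket_add_left\<close>)
  show ?thesis
    by (rule poisson_homI)
      (simp_all add: mult brack hp i' j' h linear_on_poisson)
qed

end

lemma tensor_map_hom:
  assumes P: "poisson_algebra F P" and Q: "poisson_algebra F Q"
    and P': "poisson_algebra F P'" and Q': "poisson_algebra F Q'"
    and f: "f \<in> poisson_hom F P P'" and g: "g \<in> poisson_hom F Q Q'"
  shows "tensor_map F P' Q' f g \<in> poisson_hom F (tensor_poisson F P Q) (tensor_poisson F P' Q')"
proof (rule poisson_hom_from_tensor[OF P Q tensor_poisson_algebra[OF P' Q']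
      _ poisson_hom_comp[OF f tensor_inl_hom[OF P' Q']] poisson_hom_comp[OF g tensor_inr_hom[OF P' Q']]])
  note pm = poisson_module[OF P] poisson_module[OF Q] poisson_module[OF P'] poisson_module[OF Q']
  note lin = poisson_homD(1)[OF f] poisson_homD(1)[OF g]
  show "linear_on F (tensor_space F P Q) (tensor_poisson F P' Q') (tensor_map F P' Q' f g)"
    unfolding linear_on_poisson by (rule tensor_map_linear[OF pm lin])
  fix p q assume pq: "p \<in> carrier P" "q \<in> carrier Q"
  then have pq': "f p \<in> carrier P'" "g q \<in> carrier Q'"
    using poisson_homD(3)[OF f] poisson_homD(3)[OF g] by auto
  show "bracket (tensor_poisson F P' Q') (((\<lambda>p. pure_tensor F P' Q' p \<one>\<^bsub>Q'\<^esub>) \<circ> f) p)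
      ((pure_tensor F P' Q' \<one>\<^bsub>P'\<^esub> \<circ> g) q) = \<zero>\<^bsub>tensor_poisson F P' Q'\<^esub>"
    by (simp add: tensor_inl_inr_commute[OF P' Q' pq'])
  show "tensor_map F P' Q' f g (pure_tensor F P Q p q)
    = ((\<lambda>p. pure_tensor F P' Q' p \<one>\<^bsub>Q'\<^esub>) \<circ> f) p \<otimes>\<^bsub>tensor_poisson F P' Q'\<^esub> (pure_tensor F P' Q' \<one>\<^bsub>P'\<^esub> \<circ> g) q"
    by (simp add: tensor_inl_inr_mult[OF P' Q' pq'] tensor_map_pure[OF pm lin pq])
qed

text \<open>
  The associator is the combination of the three inclusions of \<open>P\<close>, \<open>Q\<close> and \<open>R\<close> into
  \<open>P \<otimes> (Q \<otimes> R)\<close>, whose images commute pairwise for the bracket; the universal property of the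
  tensor product is used first for \<open>P \<otimes> Q\<close> and then for \<open>(P \<otimes> Q) \<otimes> R\<close>.
\<close>

lemma tensor_assoc_hom:
  assumes P: "poisson_algebra F P" and Q: "poisson_algebra F Q" and R: "poisson_algebra F R"
  shows "tensor_assoc F P Q R \<in> poisson_hom F (tensor_poisson F (tensor_poisson F P Q) R)
    (tensor_poisson F P (tensor_poisson F Q R))"
proof -
  let ?QR = "tensor_poisson F Q R" and ?PQ = "tensor_poisson F P Q"
  let ?W = "tensor_poisson F P ?QR"
  interpret PR: cring P by (rule poisson_cring[OF P])
  interpret QR: cring Q by (rule poisson_cring[OF Q])
  interpret RR: cring R by (rule poisson_cring[OF R])
  note pm = poisson_module[OF P] poisson_module[OF Q] poisson_module[OF R]
  note QR = tensor_poisson_algebra[OF Q R] and PQ = tensor_poisson_algebra[OF P Q]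
  note W = tensor_poisson_algebra[OF P QR]
  interpret WR: cring ?W by (rule poisson_cring[OF W])
  interpret W: poisson_algebra F ?W by (rule W)
  define i where "i = (\<lambda>p. pure_tensor F P ?QR p \<one>\<^bsub>?QR\<^esub>)"
  define j where "j = pure_tensor F P ?QR \<one>\<^bsub>P\<^esub> \<circ> (\<lambda>q. pure_tensor F Q R q \<one>\<^bsub>R\<^esub>)"
  define k where "k = pure_tensor F P ?QR \<one>\<^bsub>P\<^esub> \<circ> pure_tensor F Q R \<one>\<^bsub>Q\<^esub>"
  \<comment> \<open>The restriction of the associator to \<open>P \<otimes> Q\<close>.\<close>
  define t where "t = (\<lambda>A. tensor_assoc F P Q R (pure_tensor F ?PQ R A \<one>\<^bsub>R\<^esub>))"
  have i: "i \<in> poisson_hom F P ?W" unfolding i_def by (rule tensor_inl_hom[OF P QR])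
  have j: "j \<in> poisson_hom F Q ?W" unfolding j_def
    by (rule poisson_hom_comp[OF tensor_inl_hom[OF Q R] tensor_inr_hom[OF P QR]])
  have k: "k \<in> poisson_hom F R ?W" unfolding k_def
    by (rule poisson_hom_comp[OF tensor_inr_hom[OF Q R] tensor_inr_hom[OF P QR]])
  note ijk = poisson_homD(3)[OF i] poisson_homD(3)[OF j] poisson_homD(3)[OF k]
  note ptc = pure_tensor_closed[OF pm(2,3)]
  have ij: "bracket ?W (i p) (j q) = \<zero>\<^bsub>?W\<^esub>" if "p \<in> carrier P" "q \<in> carrier Q" for p q
    using tensor_inl_inr_commute[OF P QR that(1)] that unfolding i_def j_def by (simp add: ptc)
  have ik: "bracket ?W (i p) (k r) = \<zero>\<^bsub>?W\<^esub>" if "p \<in> carrier P" "r \<in> carrier R" for p r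
    using tensor_inl_inr_commute[OF P QR that(1)] that unfolding i_def k_def by (simp add: ptc)
  have jk: "bracket ?W (j q) (k r) = \<zero>\<^bsub>?W\<^esub>" if qr: "q \<in> carrier Q" "r \<in> carrier R" for q r
  proof -
    let ?c = "pure_tensor F P ?QR \<one>\<^bsub>P\<^esub>"
    have "bracket ?W (j q) (k r)
      = ?c (bracket ?QR (pure_tensor F Q R q \<one>\<^bsub>R\<^esub>) (pure_tensor F Q R \<one>\<^bsub>Q\<^esub> r))"
      using qr poisson_homD(7)[OF tensor_inr_hom[OF P QR]] by (simp add: j_def k_def ptc)
    also have "\<dots> = ?c \<zero>\<^bsub>?QR\<^esub>" by (simp add: tensor_inl_inr_commute[OF Q R qr])
    also have "\<dots> = \<zero>\<^bsub>?W\<^esub>"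
      using linear_on_zero[OF poisson_module[OF QR] poisson_module[OF W]
          poisson_homD(1)[OF tensor_inr_hom[OF P QR]]] by simp
    finally show ?thesis .
  qed
  have assoc_pure: "tensor_assoc F P Q R (pure_tensor F ?PQ R (pure_tensor F P Q p q) r)
    = i p \<otimes>\<^bsub>?W\<^esub> j q \<otimes>\<^bsub>?W\<^esub> k r" if pqr: "p \<in> carrier P" "q \<in> carrier Q" "r \<in> carrier R" for p q r
  proof -
    have "j q \<otimes>\<^bsub>?W\<^esub> k r = pure_tensor F P ?QR \<one>\<^bsub>P\<^esub>
        (pure_tensor F Q R q \<one>\<^bsub>R\<^esub> \<otimes>\<^bsub>?QR\<^esub> pure_tensor F Q R \<one>\<^bsub>Q\<^esub> r)"
      using pqr poisson_homD(6)[OF tensor_inr_hom[OF P QR]] by (simp add: j_def k_def ptc)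
    then have "i p \<otimes>\<^bsub>?W\<^esub> (j q \<otimes>\<^bsub>?W\<^esub> k r) = pure_tensor F P ?QR p (pure_tensor F Q R q r)"
      using tensor_inl_inr_mult[OF P QR pqr(1)] pqr
      by (simp add: i_def tensor_inl_inr_mult[OF Q R] ptc)
    then show ?thesis
      using WR.m_assoc[OF ijk] pqr
      by (simp add: tensor_assoc_pure[OF pm] pure_tensor_poisson)
  qed
  have lin: "linear_on F (tensor_space F ?PQ R) ?W (tensor_assoc F P Q R)"
    unfolding tensor_poisson_as_space by (rule tensor_assoc_linear[OF pm])
  have t_lin: "linear_on F (tensor_space F P Q) ?W t"
    using linear_on_comp[OF pure_tensor_linear(1)[OF poisson_module[OF PQ] pm(3) RR.one_closed] lin]
    unfolding t_def comp_def by (simp add: linear_on_poisson)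
  have t_pure: "t (pure_tensor F P Q p q) = i p \<otimes>\<^bsub>?W\<^esub> j q"
    if pq: "p \<in> carrier P" "q \<in> carrier Q" for p q
    using pq ijk(1)[OF pq(1)] ijk(2)[OF pq(2)] poisson_homD(2)[OF k]
    by (simp only: t_def assoc_pure RR.one_closed WR.r_one WR.m_closed)
  have t: "t \<in> poisson_hom F ?PQ ?W"
    by (rule poisson_hom_from_tensor[OF P Q W t_lin i j ij t_pure])
  have tk: "bracket ?W (t A) (k r) = \<zero>\<^bsub>?W\<^esub>" if A: "A \<in> carrier ?PQ" and r: "r \<in> carrier R" for A r
    using A[simplified]
  proof (induction rule: tensor_induct[OF pm(1,2), consumes 1, case_names pure add])
    case (pure p q)
    then show ?case
      using r by (simp only: t_pure poisson_leibniz_left[OF W] ijk ik jk WR.l_null WR.r_null WR.r_zero WR.zero_closed)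
  next
    case (add A B)
    then show ?case
      using r linear_onD[OF t_lin] W.bracket_add_left[OF _ _ ijk(3)[OF r]] WR.r_zero[OF WR.zero_closed]
      by simp
  qed
  have tk_mult: "tensor_assoc F P Q R (pure_tensor F ?PQ R A r) = t A \<otimes>\<^bsub>?W\<^esub> k r"
    if A: "A \<in> carrier ?PQ" and r: "r \<in> carrier R" for A r
  proof -
    have 1: "linear_on F (tensor_space F P Q) ?W (\<lambda>A. tensor_assoc F P Q R (pure_tensor F ?PQ R A r))"
      using linear_on_comp[OF pure_tensor_linear(1)[OF poisson_module[OF PQ] pm(3) r] lin]
      by (simp add: linear_on_poisson comp_def)
    have 2: "linear_on F (tensor_space F P Q) ?W (\<lambda>A. t A \<otimes>\<^bsub>?W\<^esub> k r)"
      using linear_on_comp[OF t_lin poisson_mult_linear(1)[OF W ijk(3)[OF r]]] by (simp add: comp_def)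
    show ?thesis
      by (rule tensor_ext[OF pm(1,2) 1 2]) (use A r in \<open>simp_all add: assoc_pure t_pure\<close>)
  qed
  show ?thesis
    by (rule poisson_hom_from_tensor[OF PQ R W lin t k tk tk_mult])
qed

lemma left_unitor_hom:
  assumes B: "poisson_algebra F B"
  shows "tensor_lift B (\<lambda>c x. c \<odot>\<^bsub>B\<^esub> x) \<in> poisson_hom F (tensor_poisson F (base_poisson F) B) B"
    and "c \<in> carrier F \<Longrightarrow> x \<in> carrier B \<Longrightarrow>
      tensor_lift B (\<lambda>c x. c \<odot>\<^bsub>B\<^esub> x) (pure_tensor F (base_poisson F) B c x) = c \<odot>\<^bsub>B\<^esub> x"
proof -
  interpret BR: cring B by (rule poisson_cring[OF B])
  interpret BM: module F B by (rule poisson_module[OF B])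
  interpret B: poisson_algebra F B by (rule B)
  have F: "poisson_algebra F (base_poisson F)" by (rule base_poisson_algebra[OF B.field_axioms])
  have "bilinear_on F (base_poisson F) B B (\<lambda>c x. c \<odot>\<^bsub>B\<^esub> x)"
    unfolding bilinear_on_def
    by (simp add: BM.smult_l_distr BM.smult_r_distr BM.smult_assoc1[symmetric] BM.R.m_comm)
  note * = tensor_universal[OF poisson_module[OF F] poisson_module[OF B] poisson_module[OF B] this]
  show pure: "tensor_lift B (\<lambda>c x. c \<odot>\<^bsub>B\<^esub> x) (pure_tensor F (base_poisson F) B c x) = c \<odot>\<^bsub>B\<^esub> x"
    if "c \<in> carrier F" "x \<in> carrier B" for c x
    using *(2)[of c x] that by simp
  have i: "(\<lambda>c. c \<odot>\<^bsub>B\<^esub> \<one>\<^bsub>B\<^esub>) \<in> poisson_hom F (base_poisson F) B"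
    by (rule poisson_homI)
      (auto intro!: linear_onI simp: BM.smult_l_distr BM.smult_assoc1 B.smult_assoc2
        B.bracket_smult_left B.bracket_smult_right B.bracket_alternating)
  show "tensor_lift B (\<lambda>c x. c \<odot>\<^bsub>B\<^esub> x) \<in> poisson_hom F (tensor_poisson F (base_poisson F) B) B"
    by (rule poisson_hom_from_tensor[OF F B B *(1) i poisson_hom_id])
      (simp_all add: pure B.smult_assoc2 B.bracket_smult_left poisson_bracket_one[OF B])
qed

lemma right_unitor_hom:
  assumes B: "poisson_algebra F B"
  shows "tensor_lift B (\<lambda>x c. c \<odot>\<^bsub>B\<^esub> x) \<in> poisson_hom F (tensor_poisson F B (base_poisson F)) B"
    and "c \<in> carrier F \<Longrightarrow> x \<in> carrier B \<Longrightarrow>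
      tensor_lift B (\<lambda>x c. c \<odot>\<^bsub>B\<^esub> x) (pure_tensor F B (base_poisson F) x c) = c \<odot>\<^bsub>B\<^esub> x"
proof -
  interpret BR: cring B by (rule poisson_cring[OF B])
  interpret BM: module F B by (rule poisson_module[OF B])
  interpret B: poisson_algebra F B by (rule B)
  have F: "poisson_algebra F (base_poisson F)" by (rule base_poisson_algebra[OF B.field_axioms])
  have "bilinear_on F B (base_poisson F) B (\<lambda>x c. c \<odot>\<^bsub>B\<^esub> x)"
    unfolding bilinear_on_def
    by (simp add: BM.smult_l_distr BM.smult_r_distr BM.smult_assoc1[symmetric] BM.R.m_comm)
  note * = tensor_universal[OF poisson_module[OF B] poisson_module[OF F] poisson_module[OF B] this]
  show pure: "tensor_lift B (\<lambda>x c. c \<odot>\<^bsub>B\<^esub> x) (pure_tensor F B (base_poisson F) x c) = c \<odot>\<^bsub>B\<^esub> x"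
    if "c \<in> carrier F" "x \<in> carrier B" for c x
    using *(2)[of x c] that by simp
  have j: "(\<lambda>c. c \<odot>\<^bsub>B\<^esub> \<one>\<^bsub>B\<^esub>) \<in> poisson_hom F (base_poisson F) B"
    by (rule poisson_homI)
      (auto intro!: linear_onI simp: BM.smult_l_distr BM.smult_assoc1 B.smult_assoc2
        B.bracket_smult_left B.bracket_smult_right B.bracket_alternating)
  show "tensor_lift B (\<lambda>x c. c \<odot>\<^bsub>B\<^esub> x) \<in> poisson_hom F (tensor_poisson F B (base_poisson F)) B"
    by (rule poisson_hom_from_tensor[OF B F B *(1) poisson_hom_id j])
      (simp_all add: pure linear_onD(3)[OF poisson_mult_linear(2)[OF B]] B.bracket_smult_right poisson_bracket_one[OF B])
qed


section \<open>Coactions\<close>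

text \<open>
  The map \<open>\<phi>\<close> is thought of as a coaction of \<open>B\<close> on \<open>U\<close> with comultiplication \<open>\<Delta>\<close>.  Their
  compatibility is assumed at an element \<open>x\<close> of \<open>U \<otimes> B\<close>: for \<open>x = \<psi>(p)\<close> it is the defining
  property of the comultiplication, although \<open>\<psi>(p)\<close> may lie outside the image of \<open>\<phi> = \<psi> \<circ> f\<close>.
\<close>

context
  fixes F :: "('f, 'k) ring_scheme" and U :: "('f, 'u, 'x) module_scheme"
    and B :: "('f, 'b, 'y) module_scheme"
    and \<phi> :: "'u \<Rightarrow> ('u \<times> 'b) list set" and \<Delta> :: "'b \<Rightarrow> ('b \<times> 'b) list set"
    and x :: "('u \<times> 'b) list set"
  assumes U: "module F U" and B: "module F B"
    and \<phi>: "linear_on F U (tensor_space F U B) \<phi>" and \<Delta>: "linear_on F B (tensor_space F B B) \<Delta>"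
    and x: "x \<in> carrier (tensor_space F U B)"
    and \<Delta>_x: "tensor_map F U (tensor_space F B B) id \<Delta> x
      = tensor_assoc F U B B (tensor_map F (tensor_space F U B) B \<phi> id x)"
begin

private lemmas UB = tensor_space_module[OF U B] and BB = tensor_space_module[OF B B]
private lemmas \<rho> = tensor_map_linear[OF U B UB B \<phi> linear_on_id]

text \<open>
  Naturality of the associator moves a map \<open>h\<close> applied to one of the two tensor factors created
  by \<open>\<Delta>\<close> to the other side of the hypothesis on \<open>x\<close>.
\<close>

lemma coaction_then_left_factor:
  assumes N: "module F N" and h: "linear_on F B N h"
  shows "tensor_map F U (tensor_space F N B) id (tensor_map F N B h id \<circ> \<Delta>) x
    = tensor_assoc F U N B (tensor_map F (tensor_space F U N) B (tensor_map F U N id h \<circ> \<phi>) id x)"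
proof -
  let ?\<rho>x = "tensor_map F (tensor_space F U B) B \<phi> id x"
  note NB = tensor_space_module[OF N B] and UN = tensor_space_module[OF U N]
  have "tensor_map F U (tensor_space F N B) id (tensor_map F N B h id \<circ> \<Delta>) x
    = tensor_map F U (tensor_space F N B) id (tensor_map F N B h id)
        (tensor_map F U (tensor_space F B B) id \<Delta> x)"
    using tensor_map_comp[OF U B U BB U NB linear_on_id \<Delta> linear_on_id
        tensor_map_linear[OF B B N B h linear_on_id] x] by simp
  also have "\<dots> = tensor_assoc F U N B
      (tensor_map F (tensor_space F U N) B (tensor_map F U N id h) id ?\<rho>x)"
    unfolding \<Delta>_x
    by (rule tensor_assoc_natural[OF U B B U N B linear_on_id h linear_on_id linear_onD(1)[OF \<rho> x], symmetric])
  also have "tensor_map F (tensor_space F U N) B (tensor_map F U N id h) id ?\<rho>x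
    = tensor_map F (tensor_space F U N) B (tensor_map F U N id h \<circ> \<phi>) id x"
    using tensor_map_comp[OF U B UB B UN B \<phi> linear_on_id
        tensor_map_linear[OF U B U N linear_on_id h] linear_on_id x] by simp
  finally show ?thesis .
qed

lemma coaction_then_right_factor:
  assumes N: "module F N" and h: "linear_on F B N h"
  shows "tensor_map F U (tensor_space F B N) id (tensor_map F B N id h \<circ> \<Delta>) x
    = tensor_assoc F U B N (tensor_map F (tensor_space F U B) N \<phi> id (tensor_map F U N id h x))"
proof -
  let ?\<rho>x = "tensor_map F (tensor_space F U B) B \<phi> id x"
  note BN = tensor_space_module[OF B N]
  have "tensor_map F U (tensor_space F B N) id (tensor_map F B N id h \<circ> \<Delta>) x
    = tensor_map F U (tensor_space F B N) id (tensor_map F B N id h)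
        (tensor_map F U (tensor_space F B B) id \<Delta> x)"
    using tensor_map_comp[OF U B U BB U BN linear_on_id \<Delta> linear_on_id
        tensor_map_linear[OF B B B N linear_on_id h] x] by simp
  also have "\<dots> = tensor_assoc F U B N
      (tensor_map F (tensor_space F U B) N (tensor_map F U B id id) h ?\<rho>x)"
    unfolding \<Delta>_x
    by (rule tensor_assoc_natural[OF U B B U B N linear_on_id linear_on_id h linear_onD(1)[OF \<rho> x], symmetric])
  also have "tensor_map F (tensor_space F U B) N (tensor_map F U B id id) h ?\<rho>x
    = tensor_map F (tensor_space F U B) N (tensor_map F U B id id \<circ> \<phi>) h x"
    using tensor_map_comp[OF U B UB B UB N \<phi> linear_on_id
        tensor_map_linear[OF U B U B linear_on_id linear_on_id] h x] by simp
  also have "\<dots> = tensor_map F (tensor_space F U B) N \<phi> h x"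
    by (rule tensor_map_cong[OF U B UB N \<phi> h _ _ x])
      (simp_all add: tensor_map_id[OF U B] linear_onD[OF \<phi>])
  also have "\<dots> = tensor_map F (tensor_space F U B) N \<phi> id (tensor_map F U N id h x)"
    using tensor_map_comp[OF U B U N UB N linear_on_id h \<phi> linear_on_id x] by simp
  finally show ?thesis .
qed

text \<open>
  If the compatibility of \<open>\<Delta>\<close> and \<open>\<phi>\<close> holds at \<open>x\<close> and on the image of \<open>\<phi>\<close>, then both
  ways of applying \<open>\<Delta>\<close> twice amount to applying \<open>\<phi>\<close> twice, up to rebracketing; the pentagon
  identity says that the two rebracketings agree.
\<close>

lemma coaction_coassociative:
  assumes \<Delta>_\<phi>: "\<And>u. u \<in> carrier U \<Longrightarrow> tensor_map F U (tensor_space F B B) id \<Delta> (\<phi> u)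
      = tensor_assoc F U B B (tensor_map F (tensor_space F U B) B \<phi> id (\<phi> u))"
  shows "tensor_map F U (tensor_space F B (tensor_space F B B)) id
      (tensor_assoc F B B B \<circ> (tensor_map F (tensor_space F B B) B \<Delta> id \<circ> \<Delta>)) x
    = tensor_map F U (tensor_space F B (tensor_space F B B)) id
      (tensor_map F B (tensor_space F B B) id \<Delta> \<circ> \<Delta>) x"
proof -
  let ?UB = "tensor_space F U B" and ?BB = "tensor_space F B B"
  let ?\<rho> = "tensor_map F ?UB B \<phi> id"
  note BB_B = tensor_space_module[OF BB B] and B_BB = tensor_space_module[OF B BB]
    and U_BB = tensor_space_module[OF U BB] and UB_B = tensor_space_module[OF UB B]
  note a = tensor_assoc_linear[OF U B B]
  note \<rho>x = linear_onD(1)[OF \<rho> x]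
  note \<rho>\<rho> = tensor_map_linear[OF UB B UB_B B \<rho> linear_on_id]
  note \<Delta>\<Delta> = tensor_map_linear[OF B B BB B \<Delta> linear_on_id]
  have "tensor_map F U (tensor_space F B ?BB) id
      (tensor_assoc F B B B \<circ> (tensor_map F ?BB B \<Delta> id \<circ> \<Delta>)) x
    = tensor_map F U (tensor_space F B ?BB) id (tensor_assoc F B B B)
        (tensor_map F U (tensor_space F ?BB B) id (tensor_map F ?BB B \<Delta> id \<circ> \<Delta>) x)"
    using tensor_map_comp[OF U B U BB_B U B_BB linear_on_id linear_on_comp[OF \<Delta> \<Delta>\<Delta>]
        linear_on_id tensor_assoc_linear[OF B B B] x] by simp
  also have "tensor_map F U (tensor_space F ?BB B) id (tensor_map F ?BB B \<Delta> id \<circ> \<Delta>) x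
    = tensor_assoc F U ?BB B (tensor_map F (tensor_space F U ?BB) B (tensor_map F U ?BB id \<Delta> \<circ> \<phi>) id x)"
    by (rule coaction_then_left_factor[OF BB \<Delta>])
  also have "tensor_map F (tensor_space F U ?BB) B (tensor_map F U ?BB id \<Delta> \<circ> \<phi>) id x
    = tensor_map F (tensor_space F U ?BB) B (tensor_assoc F U B B \<circ> (?\<rho> \<circ> \<phi>)) id x"
    by (rule tensor_map_cong[OF U B U_BB B linear_on_comp[OF linear_on_comp[OF \<phi> \<rho>] a] linear_on_id _ _ x])
      (simp_all add: \<Delta>_\<phi>)
  also have "\<dots> = tensor_map F (tensor_space F U ?BB) B (tensor_assoc F U B B) id
      (tensor_map F (tensor_space F ?UB B) B (?\<rho> \<circ> \<phi>) id x)"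
    using tensor_map_comp[OF U B UB_B B U_BB B linear_on_comp[OF \<phi> \<rho>] linear_on_id a linear_on_id x]
    by simp
  also have "tensor_map F (tensor_space F ?UB B) B (?\<rho> \<circ> \<phi>) id x
    = tensor_map F (tensor_space F ?UB B) B ?\<rho> id (?\<rho> x)"
    using tensor_map_comp[OF U B UB B UB_B B \<phi> linear_on_id \<rho> linear_on_id x] by simp
  also have "tensor_map F U (tensor_space F B ?BB) id (tensor_assoc F B B B)
      (tensor_assoc F U ?BB B (tensor_map F (tensor_space F U ?BB) B (tensor_assoc F U B B) id
        (tensor_map F (tensor_space F ?UB B) B ?\<rho> id (?\<rho> x))))
    = tensor_assoc F U B ?BB (tensor_assoc F ?UB B B
        (tensor_map F (tensor_space F ?UB B) B ?\<rho> id (?\<rho> x)))"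
    by (rule tensor_assoc_pentagon[OF U B B B linear_onD(1)[OF \<rho>\<rho> \<rho>x]])
  also have "tensor_assoc F ?UB B B (tensor_map F (tensor_space F ?UB B) B ?\<rho> id (?\<rho> x))
    = tensor_map F ?UB ?BB \<phi> (tensor_map F B B id id) (tensor_assoc F U B B (?\<rho> x))"
    by (rule tensor_assoc_natural[OF U B B UB B B \<phi> linear_on_id linear_on_id \<rho>x])
  also have "\<dots> = tensor_map F ?UB ?BB \<phi> id (tensor_assoc F U B B (?\<rho> x))"
    by (rule tensor_map_cong[OF U BB UB BB \<phi> linear_on_id])
      (simp_all add: tensor_map_id[OF B B] linear_onD(1)[OF a \<rho>x])
  also have "tensor_assoc F U B ?BB \<dots>
    = tensor_map F U (tensor_space F B ?BB) id (tensor_map F B ?BB id \<Delta> \<circ> \<Delta>) x"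
    unfolding coaction_then_right_factor[OF BB \<Delta>] \<Delta>_x ..
  finally show ?thesis .
qed

text \<open>
  Here \<open>I\<close> with its element \<open>e\<close> plays the role of the ground field with \<open>1\<close>, and \<open>l\<close> that of the
  isomorphism \<open>I \<otimes> B \<rightarrow> B\<close>.  Applying \<open>\<epsilon>\<close> to the left factor created by \<open>\<Delta>\<close> undoes
  the \<open>\<phi>\<close> that created it, up to \<open>\<gamma>\<close>.
\<close>

lemma coaction_counit_left:
  assumes I: "module F I" and \<epsilon>: "linear_on F B I \<epsilon>" and e: "e \<in> carrier I"
    and l: "linear_on F (tensor_space F I B) B l" "\<And>b. b \<in> carrier B \<Longrightarrow> l (pure_tensor F I B e b) = b"
    and \<gamma>: "linear_on F U U \<gamma>"
    and \<epsilon>_\<phi>: "\<And>u. u \<in> carrier U \<Longrightarrow> tensor_map F U I id \<epsilon> (\<phi> u) = pure_tensor F U I (\<gamma> u) e"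
  shows "tensor_map F U B id (l \<circ> (tensor_map F I B \<epsilon> id \<circ> \<Delta>)) x = tensor_map F U B \<gamma> id x"
proof -
  note IB = tensor_space_module[OF I B] and UI = tensor_space_module[OF U I]
  note \<iota> = pure_tensor_linear(1)[OF U I e]
  note a = tensor_assoc_linear[OF U I B] and m = tensor_map_linear[OF U IB U B linear_on_id l(1)]
  note j = tensor_map_linear[OF U B UI B linear_on_comp[OF \<gamma> \<iota>] linear_on_id]
  have "tensor_map F U B id (l \<circ> (tensor_map F I B \<epsilon> id \<circ> \<Delta>)) x
    = tensor_map F U B id l (tensor_map F U (tensor_space F I B) id (tensor_map F I B \<epsilon> id \<circ> \<Delta>) x)"
    using tensor_map_comp[OF U B U IB U B linear_on_id
        linear_on_comp[OF \<Delta> tensor_map_linear[OF B B I B \<epsilon> linear_on_id]] linear_on_id l(1) x] by simp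
  also have "\<dots> = tensor_map F U B id l (tensor_assoc F U I B
      (tensor_map F (tensor_space F U I) B (tensor_map F U I id \<epsilon> \<circ> \<phi>) id x))"
    by (simp only: coaction_then_left_factor[OF I \<epsilon>])
  also have "tensor_map F (tensor_space F U I) B (tensor_map F U I id \<epsilon> \<circ> \<phi>) id x
    = tensor_map F (tensor_space F U I) B ((\<lambda>u. pure_tensor F U I u e) \<circ> \<gamma>) id x"
    by (rule tensor_map_cong[OF U B UI B linear_on_comp[OF \<gamma> \<iota>] linear_on_id _ _ x]) (simp_all add: \<epsilon>_\<phi>)
  also have "tensor_map F U B id l (tensor_assoc F U I B \<dots>) = tensor_map F U B \<gamma> id x"
    using tensor_ext[OF U B linear_on_comp[OF linear_on_comp[OF j a] m]
        tensor_map_linear[OF U B U B \<gamma> linear_on_id] _ x] e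
    by (simp add: tensor_map_pure[OF U B UI B linear_on_comp[OF \<gamma> \<iota>] linear_on_id]
        tensor_assoc_pure[OF U I B] tensor_map_pure[OF U IB U B linear_on_id l(1)] linear_onD[OF \<gamma>]
        tensor_map_pure[OF U B U B \<gamma> linear_on_id] pure_tensor_closed[OF I B] l(2))
  finally show ?thesis .
qed

text \<open>
  Applying \<open>\<epsilon>\<close> to the right factor first turns \<open>x\<close> into \<open>v \<otimes> e\<close>, and then \<open>\<phi>\<close> acts on
  \<open>v\<close> alone.
\<close>

lemma coaction_counit_right:
  assumes I: "module F I" and \<epsilon>: "linear_on F B I \<epsilon>" and e: "e \<in> carrier I"
    and r: "linear_on F (tensor_space F B I) B r" "\<And>b. b \<in> carrier B \<Longrightarrow> r (pure_tensor F B I b e) = b"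
    and v: "v \<in> carrier U" and \<epsilon>_x: "tensor_map F U I id \<epsilon> x = pure_tensor F U I v e"
  shows "tensor_map F U B id (r \<circ> (tensor_map F B I id \<epsilon> \<circ> \<Delta>)) x = \<phi> v"
proof -
  note BI = tensor_space_module[OF B I]
  note \<iota> = pure_tensor_linear(1)[OF UB I e]
  note a = tensor_assoc_linear[OF U B I] and m = tensor_map_linear[OF U BI U B linear_on_id r(1)]
  have "tensor_map F U B id (r \<circ> (tensor_map F B I id \<epsilon> \<circ> \<Delta>)) x
    = tensor_map F U B id r (tensor_map F U (tensor_space F B I) id (tensor_map F B I id \<epsilon> \<circ> \<Delta>) x)"
    using tensor_map_comp[OF U B U BI U B linear_on_id
        linear_on_comp[OF \<Delta> tensor_map_linear[OF B B B I linear_on_id \<epsilon>]] linear_on_id r(1) x] by simp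
  also have "\<dots> = tensor_map F U B id r (tensor_assoc F U B I (pure_tensor F (tensor_space F U B) I (\<phi> v) e))"
    by (simp add: coaction_then_right_factor[OF I \<epsilon>] \<epsilon>_x e v tensor_map_pure[OF U I UB I \<phi> linear_on_id])
  also have "\<dots> = \<phi> v"
    using tensor_ext[OF U B linear_on_comp[OF linear_on_comp[OF \<iota> a] m] linear_on_id _ linear_onD(1)[OF \<phi> v]] e
    by (simp add: tensor_assoc_pure[OF U B I] tensor_map_pure[OF U BI U B linear_on_id r(1)]
        pure_tensor_closed[OF B I] r(2))
  finally show ?thesis .
qed

end


section \<open>Embedding tensor products into types of lists\<close>

text \<open>
  A self-delimiting code: the length in unary, an end mark, then the list.  Concatenating code words
  therefore encodes a list of lists as a list.
\<close>

definition encode_list :: "'a \<Rightarrow> 'a \<Rightarrow> 'a list \<Rightarrow> 'a list"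
  where "encode_list a b xs = replicate (length xs) a @ b # xs"

lemma encode_list_prefix_free:
  assumes ab: "a \<noteq> b" and eq: "encode_list a b xs @ us = encode_list a b ys @ vs"
  shows "xs = ys \<and> us = vs"
proof -
  have *: "m = n \<and> us = vs" if "replicate m a @ b # us = replicate n a @ b # vs" for m n us vs
    using that
  proof (induction m arbitrary: n)
    case 0 then show ?case using ab by (cases n) auto
  next
    case (Suc m) then show ?case using ab by (cases n) auto
  qed
  show ?thesis
    using *[of "length xs" "xs @ us" "length ys" "ys @ vs"] eq by (auto simp: encode_list_def)
qed

lemma inj_concat_encode_list:
  assumes ab: "a \<noteq> b"
  shows "inj (\<lambda>xss. concat (map (encode_list a b) xss))"
proof (rule injI)
  fix xss yss assume "concat (map (encode_list a b) xss) = concat (map (encode_list a b) yss)"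
  then show "xss = yss"
  proof (induction xss arbitrary: yss)
    case Nil then show ?case by (cases yss) (auto simp: encode_list_def)
  next
    case (Cons xs xss)
    then obtain ys yss' where yss: "yss = ys # yss'"
      by (cases yss) (auto simp: encode_list_def)
    then show ?case
      using Cons encode_list_prefix_free[OF ab, of xs _ ys] by auto
  qed
qed

text \<open>
  An element of the tensor product is determined by any formal sum representing it, and a formal sum
  is a list of pairs.  So if the factors embed into the type of lists over an alphabet with at least two letters, the tensor
  product embeds into the same type, and iterated tensor products do as well.
\<close>

lemma tensor_space_embedding:
  fixes e :: "'m \<Rightarrow> 'a list" and e' :: "'n \<Rightarrow> 'a list"
  assumes M: "module F M" and N: "module F N"
    and e: "inj_on e (carrier M)" and e': "inj_on e' (carrier N)" and ab: "(a :: 'a) \<noteq> b"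
  shows "\<exists>e'' :: _ \<Rightarrow> 'a list. inj_on e'' (carrier (tensor_space F M N))"
proof -
  let ?L = "lists (carrier M \<times> carrier N)"
  define rep where "rep = (\<lambda>A :: ('m \<times> 'n) list set. SOME xs. xs \<in> A)"
  define flat where "flat = (\<lambda>xs. concat (map (\<lambda>(m, n). [e m, e' n]) xs))"
  have rep: "rep A \<in> A \<and> A = tensor_class F M N (rep A) \<and> rep A \<in> ?L"
    if A: "A \<in> carrier (tensor_space F M N)" for A
  proof -
    obtain xs where xs: "xs \<in> ?L" "A = tensor_class F M N xs"
      using A by (rule tensor_carrier_cases)
    have "xs \<in> A" unfolding xs(2) tensor_class_def using xs(1) by (auto intro: tensor_rel.perm)
    then have repA: "rep A \<in> A" unfolding rep_def by (rule someI)
    then have r: "(xs, rep A) \<in> tensor_rel F M N" unfolding xs(2) tensor_class_def by simp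
    then have "rep A \<in> ?L" using tensor_rel_carrier[OF M N] by blast
    then show ?thesis using r repA xs tensor_class_eq_iff[OF M N xs(1)] by metis
  qed
  have flat: "inj_on flat ?L"
  proof (rule inj_onI)
    fix xs ys assume "xs \<in> ?L" "ys \<in> ?L" "flat xs = flat ys"
    then show "xs = ys"
    proof (induction xs arbitrary: ys)
      case Nil then show ?case by (cases ys) (auto simp: flat_def)
    next
      case (Cons x xs)
      then obtain y ys' where ys: "ys = y # ys'" by (cases ys) (auto simp: flat_def)
      have "xs = ys'" using Cons.prems ys by (intro Cons.IH) (auto simp: flat_def split: prod.splits)
      moreover have "x = y"
        using Cons.prems Cons.hyps ys inj_onD[OF e] inj_onD[OF e']
        by (auto simp: flat_def split: prod.splits)
      ultimately show ?case by (simp add: ys)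
    qed
  qed
  have "inj_on rep (carrier (tensor_space F M N))"
    using rep by (metis inj_onI)
  moreover have "rep ` carrier (tensor_space F M N) \<subseteq> ?L"
    using rep by blast
  ultimately have "inj_on (flat \<circ> rep) (carrier (tensor_space F M N))"
    using flat inj_on_subset comp_inj_on by metis
  then have "inj_on ((\<lambda>xss. concat (map (encode_list a b) xss)) \<circ> (flat \<circ> rep)) (carrier (tensor_space F M N))"
    using inj_concat_encode_list[OF ab] inj_on_subset comp_inj_on by blast
  then show ?thesis by blast
qed


section \<open>Transport of structure\<close>

definition transport_poisson :: "('q \<Rightarrow> 'r) \<Rightarrow> ('f, 'q, 'x) poisson_scheme \<Rightarrow> ('f, 'r) poisson"
  where "transport_poisson e Q = (let d = inv_into (carrier Q) e in
    \<lparr>carrier = e ` carrier Q, monoid.mult = (\<lambda>x y. e (d x \<otimes>\<^bsub>Q\<^esub> d y)), one = e \<one>\<^bsub>Q\<^esub>,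
     zero = e \<zero>\<^bsub>Q\<^esub>, add = (\<lambda>x y. e (d x \<oplus>\<^bsub>Q\<^esub> d y)), smult = (\<lambda>c x. e (c \<odot>\<^bsub>Q\<^esub> d x)),
     bracket = (\<lambda>x y. e (bracket Q (d x) (d y)))\<rparr>)"

lemma transport_poisson:
  assumes Q: "poisson_algebra F Q" and e: "inj_on e (carrier Q)"
  shows transport_poisson_algebra: "poisson_algebra F (transport_poisson e Q)"
    and transport_hom: "e \<in> poisson_hom F Q (transport_poisson e Q)"
    and transport_inv_hom: "inv_into (carrier Q) e \<in> poisson_hom F (transport_poisson e Q) Q"
proof -
  interpret QR: cring Q by (rule poisson_cring[OF Q])
  interpret QM: module F Q by (rule poisson_module[OF Q])
  interpret Q: poisson_algebra F Q by (rule Q)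
  let ?T = "transport_poisson e Q"
  let ?d = "inv_into (carrier Q) e"
  note d = inv_into_f_f[OF e]
  have simps: "carrier ?T = e ` carrier Q" "\<one>\<^bsub>?T\<^esub> = e \<one>\<^bsub>Q\<^esub>" "\<zero>\<^bsub>?T\<^esub> = e \<zero>\<^bsub>Q\<^esub>"
    "\<And>x y. x \<in> carrier Q \<Longrightarrow> y \<in> carrier Q \<Longrightarrow> e x \<otimes>\<^bsub>?T\<^esub> e y = e (x \<otimes>\<^bsub>Q\<^esub> y)"
    "\<And>x y. x \<in> carrier Q \<Longrightarrow> y \<in> carrier Q \<Longrightarrow> e x \<oplus>\<^bsub>?T\<^esub> e y = e (x \<oplus>\<^bsub>Q\<^esub> y)"
    "\<And>c x. x \<in> carrier Q \<Longrightarrow> c \<odot>\<^bsub>?T\<^esub> e x = e (c \<odot>\<^bsub>Q\<^esub> x)"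
    "\<And>x y. x \<in> carrier Q \<Longrightarrow> y \<in> carrier Q \<Longrightarrow> bracket ?T (e x) (e y) = e (bracket Q x y)"
    by (simp_all add: transport_poisson_def Let_def d)
  have "abelian_group ?T"
  proof (rule abelian_groupI)
    fix x assume "x \<in> carrier ?T"
    then obtain q where "q \<in> carrier Q" "x = e q" by (auto simp: simps)
    then show "\<exists>y\<in>carrier ?T. y \<oplus>\<^bsub>?T\<^esub> x = \<zero>\<^bsub>?T\<^esub>"
      by (intro bexI[of _ "e (\<ominus>\<^bsub>Q\<^esub> q)"]) (auto simp: simps QR.l_neg)
  qed (auto simp: simps QR.a_ac)
  moreover have "comm_monoid ?T"
    by (rule comm_monoidI) (auto simp: simps QR.m_ac)
  ultimately have "cring ?T"
    by (rule cringI) (auto simp: simps QR.l_distr)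
  then have "algebra F ?T"
    by (intro algebraI QM.R.cring_axioms)
      (auto simp: simps QM.smult_l_distr QM.smult_r_distr QM.smult_assoc1 Q.smult_assoc2)
  then show "poisson_algebra F ?T"
    by (intro poisson_algebra.intro poisson_algebra_axioms.intro Q.field_axioms)
      (auto simp: simps Q.bracket_closed Q.bracket_add_left Q.bracket_add_right Q.bracket_smult_left
        Q.bracket_smult_right Q.bracket_alternating Q.jacobi Q.leibniz)
  show "e \<in> poisson_hom F Q ?T"
    by (rule poisson_homI) (auto intro!: linear_onI simp: simps)
  show "?d \<in> poisson_hom F ?T Q"
    by (rule poisson_homI) (auto intro!: linear_onI simp: simps d Q.bracket_closed)
qed


section \<open>Universality for test algebras of arbitrary type\<close>

context
  fixes F :: "('f, 'k) ring_scheme"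
    and P :: "('f, 'p, 'x) poisson_scheme"
    and U :: "('f, 'u, 'y) poisson_scheme"
    and B :: "('f, 'b, 'z) poisson_scheme"
    and Q :: "('f, 'q, 'w) poisson_scheme"
    and \<psi> :: "'p \<Rightarrow> ('u \<times> 'b) list set"
    and e :: "'q \<Rightarrow> 't"
  assumes U: "poisson_algebra F U"
    and univ: "universal_coacting TYPE('t) F P U B \<psi>"
    and Q: "poisson_algebra F Q" and e: "inj_on e (carrier Q)"
begin

private lemma B: "poisson_algebra F B" and \<psi>: "\<psi> \<in> poisson_hom F P (tensor_poisson F U B)"
  using univ unfolding universal_coacting_def by auto

private abbreviation (input) "T \<equiv> transport_poisson e Q"
private abbreviation (input) "d \<equiv> inv_into (carrier Q) e"

private lemmas T = transport_poisson_algebra[OF Q e]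
  and e_hom = transport_hom[OF Q e] and d_hom = transport_inv_hom[OF Q e]

private lemmas univ_T =
  bspec[OF mp[OF spec[OF conjunct2[OF conjunct2[OF univ[unfolded universal_coacting_def]]]] T]]

private lemma universal_comp:
  assumes k: "k \<in> poisson_hom F B X" and X: "poisson_algebra F X" and Y: "poisson_algebra F Y"
    and l: "l \<in> poisson_hom F X Y" and p: "p \<in> carrier P"
  shows "tensor_map F U Y id l (tensor_map F U X id k (\<psi> p)) = tensor_map F U Y id (l \<circ> k) (\<psi> p)"
  using tensor_map_comp[OF poisson_module[OF U] poisson_module[OF B] poisson_module[OF U] poisson_module[OF X]
      poisson_module[OF U] poisson_module[OF Y] linear_on_id poisson_homD(1)[OF k] linear_on_id poisson_homD(1)[OF l]]
    poisson_homD(3)[OF \<psi> p] by simp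

text \<open>
  Universality is stated for test algebras in one type \<open>'t\<close>.  It extends to every \<open>Q\<close> that embeds
  into \<open>'t\<close>, because \<open>Q\<close> is isomorphic to a Poisson algebra carried by a subset of \<open>'t\<close>.
\<close>

lemma universal_coacting_exists:
  assumes h: "h \<in> poisson_hom F P (tensor_poisson F U Q)"
  shows "\<exists>k\<in>poisson_hom F B Q. \<forall>p\<in>carrier P. tensor_map F U Q id k (\<psi> p) = h p"
proof -
  let ?h = "tensor_map F U T id e \<circ> h"
  have h': "?h \<in> poisson_hom F P (tensor_poisson F U T)"
    by (rule poisson_hom_comp[OF h tensor_map_hom[OF U Q U T poisson_hom_id e_hom]])
  then obtain k where k: "k \<in> poisson_hom F B T" "\<And>p. p \<in> carrier P \<Longrightarrow> tensor_map F U T id k (\<psi> p) = ?h p"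
    using univ_T[OF h'] by auto
  have "tensor_map F U Q id (d \<circ> k) (\<psi> p) = h p" if p: "p \<in> carrier P" for p
  proof -
    have hp: "h p \<in> carrier (tensor_space F U Q)"
      using poisson_homD(3)[OF h p] by simp
    have "tensor_map F U Q id (d \<circ> k) (\<psi> p) = tensor_map F U Q id d (tensor_map F U T id e (h p))"
      using universal_comp[OF k(1) T Q d_hom p] k(2)[OF p] by simp
    also have "\<dots> = tensor_map F U Q id (d \<circ> e) (h p)"
      using tensor_map_comp[OF poisson_module[OF U] poisson_module[OF Q] poisson_module[OF U] poisson_module[OF T]
          poisson_module[OF U] poisson_module[OF Q] linear_on_id poisson_homD(1)[OF e_hom]
          linear_on_id poisson_homD(1)[OF d_hom] hp] by simp
    also have "\<dots> = tensor_map F U Q id id (h p)"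
      by (rule tensor_map_cong[OF poisson_module[OF U] poisson_module[OF Q] poisson_module[OF U] poisson_module[OF Q]
          linear_on_id linear_on_id _ _ hp]) (simp_all add: inv_into_f_f[OF e])
    also have "\<dots> = h p"
      by (rule tensor_map_id[OF poisson_module[OF U] poisson_module[OF Q] hp])
    finally show ?thesis .
  qed
  then show ?thesis using poisson_hom_comp[OF k(1) d_hom] by blast
qed

lemma universal_coacting_unique:
  assumes k: "k \<in> poisson_hom F B Q" and k': "k' \<in> poisson_hom F B Q"
    and eq: "\<And>p. p \<in> carrier P \<Longrightarrow> tensor_map F U Q id k (\<psi> p) = tensor_map F U Q id k' (\<psi> p)"
    and b: "b \<in> carrier B"
  shows "k b = k' b"
proof -
  let ?h = "tensor_map F U T id (e \<circ> k) \<circ> \<psi>"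
  note ek = poisson_hom_comp[OF k e_hom] and ek' = poisson_hom_comp[OF k' e_hom]
  have h: "?h \<in> poisson_hom F P (tensor_poisson F U T)"
    by (rule poisson_hom_comp[OF \<psi> tensor_map_hom[OF U B U T poisson_hom_id ek]])
  obtain l where l: "\<forall>k'\<in>poisson_hom F B T.
      (\<forall>p\<in>carrier P. tensor_map F U T id k' (\<psi> p) = ?h p) \<longrightarrow> (\<forall>b\<in>carrier B. k' b = l b)"
    using univ_T[OF h] by (elim bexE conjE) (rule that)
  have "tensor_map F U T id (e \<circ> k') (\<psi> p) = ?h p" if p: "p \<in> carrier P" for p
    using universal_comp[OF k Q T e_hom p] universal_comp[OF k' Q T e_hom p] eq[OF p] by simp
  then have "e (k b) = e (k' b)" using bspec[OF l ek] bspec[OF l ek'] b by simp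
  then show ?thesis using inj_onD[OF e] poisson_homD(3)[OF k b] poisson_homD(3)[OF k' b] by blast
qed

end


section \<open>The bialgebra structure\<close>

theorem theorem3p8:
  fixes F :: "('f, 'k) ring_scheme"
    and P :: "('f, 'p, 'x) poisson_scheme"
    and U :: "('f, 'u, 'y) poisson_scheme"
    and B :: "('f, 'b, 'z) poisson_scheme"
    and \<psi> :: "'p \<Rightarrow> ('u \<times> 'b) list set"
    and f :: "'u \<Rightarrow> 'p"
  assumes "field F"
    and "poisson_algebra F P"
    and "poisson_algebra F U"
    and "finite_dimensional F U"
    and "universal_coacting TYPE(('f, 'p, 'b) test_universe) F P U B \<psi>"
    and "f \<in> poisson_hom F U P"
  shows "\<exists>\<Delta>. \<Delta> \<in> poisson_hom F B (tensor_poisson F B B) \<and> coassociative F B \<Delta> \<and>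
    (\<forall>g \<in> poisson_hom F P U.
       (\<forall>p\<in>carrier P. \<psi> p = \<psi> ((f \<circ> g) p)) \<and>
       (\<forall>p\<in>carrier P. \<psi> p = tensor_map F U B (g \<circ> f) id (\<psi> p)) \<longrightarrow>
       (\<exists>\<epsilon> \<in> poisson_hom F B (base_poisson F). poisson_bialgebra F B \<Delta> \<epsilon>))"
proof -
  note P = assms(2) and U = assms(3) and univ = assms(5) and f = assms(6)
  have B: "poisson_algebra F B" and \<psi>: "\<psi> \<in> poisson_hom F P (tensor_poisson F U B)"
    using univ unfolding universal_coacting_def by auto
  have I: "poisson_algebra F (base_poisson F)" by (rule base_poisson_algebra[OF assms(1)])
  note mU = poisson_module[OF U] and mB = poisson_module[OF B] and mI = poisson_module[OF I]
  let ?UB = "tensor_poisson F U B" and ?BB = "tensor_poisson F B B" and ?I = "base_poisson F"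
  note UB = tensor_poisson_algebra[OF U B] and BB = tensor_poisson_algebra[OF B B]
  note BBB = tensor_poisson_algebra[OF B BB]

  \<comment> \<open>Two distinct letters of the alphabet, from which the code words are formed.\<close>
  have sep: "(Inl \<zero>\<^bsub>F\<^esub> :: 'f + 'p + 'b) \<noteq> Inr (Inr \<zero>\<^bsub>B\<^esub>)" by simp
  define eB :: "'b \<Rightarrow> ('f, 'p, 'b) test_universe" where "eB = (\<lambda>b. [Inr (Inr b)])"
  have eB: "inj_on eB (carrier B)" by (simp add: eB_def inj_on_def)
  obtain eBB :: "_ \<Rightarrow> ('f, 'p, 'b) test_universe" where eBB: "inj_on eBB (carrier ?BB)"
    using tensor_space_embedding[OF mB mB eB eB sep] by auto
  obtain eBBB :: "_ \<Rightarrow> ('f, 'p, 'b) test_universe"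
    where eBBB: "inj_on eBBB (carrier (tensor_poisson F B ?BB))"
    using tensor_space_embedding[OF mB poisson_module[OF BB] eB eBB sep] by auto
  define eI :: "'f \<Rightarrow> ('f, 'p, 'b) test_universe" where "eI = (\<lambda>c. [Inl c])"
  have eI: "inj_on eI (carrier ?I)" by (simp add: eI_def inj_on_def)

  define \<phi> where "\<phi> = \<psi> \<circ> f"
  have \<phi>: "\<phi> \<in> poisson_hom F U ?UB" unfolding \<phi>_def by (rule poisson_hom_comp[OF f \<psi>])
  have \<phi>_lin: "linear_on F U (tensor_space F U B) \<phi>"
    using poisson_homD(1)[OF \<phi>] by (simp only: linear_on_poisson)
  \<comment> \<open>The comultiplication \<open>\<Delta>\<^sub>f\<close> is the morphism classifying \<open>P \<rightarrow> U \<otimes> B \<rightarrow> (U \<otimes> B) \<otimes> B \<cong> U \<otimes> (B \<otimes> B)\<close>.\<close>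
  have "tensor_assoc F U B B \<circ> (tensor_map F ?UB B \<phi> id \<circ> \<psi>)
      \<in> poisson_hom F P (tensor_poisson F U ?BB)"
    by (rule poisson_hom_comp[OF poisson_hom_comp[OF \<psi> tensor_map_hom[OF U B UB B \<phi> poisson_hom_id]]
        tensor_assoc_hom[OF U B B]])
  then obtain \<Delta> where \<Delta>: "\<Delta> \<in> poisson_hom F B ?BB"
    and \<Delta>_\<psi>: "\<And>p. p \<in> carrier P \<Longrightarrow> tensor_map F U ?BB id \<Delta> (\<psi> p)
      = tensor_assoc F U B B (tensor_map F ?UB B \<phi> id (\<psi> p))"
    using universal_coacting_exists[OF U univ BB eBB] by force
  have \<Delta>_lin: "linear_on F B (tensor_space F B B) \<Delta>"
    using poisson_homD(1)[OF \<Delta>] by (simp only: linear_on_poisson)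
  have \<psi>_in: "\<psi> p \<in> carrier (tensor_space F U B)" if "p \<in> carrier P" for p
    using poisson_homD(3)[OF \<psi> that] by simp
  note coaction = mU mB \<phi>_lin \<Delta>_lin \<psi>_in \<Delta>_\<psi>[unfolded tensor_map_poisson]

  have coassoc: "coassociative F B \<Delta>"
    unfolding coassociative_def
  proof
    fix b assume b: "b \<in> carrier B"
    have "(tensor_assoc F B B B \<circ> (tensor_map F ?BB B \<Delta> id \<circ> \<Delta>)) b
      = (tensor_map F B ?BB id \<Delta> \<circ> \<Delta>) b"
    proof (rule universal_coacting_unique[OF U univ BBB eBBB _ _ _ b])
      show "tensor_assoc F B B B \<circ> (tensor_map F ?BB B \<Delta> id \<circ> \<Delta>)
          \<in> poisson_hom F B (tensor_poisson F B ?BB)"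
        by (rule poisson_hom_comp[OF poisson_hom_comp[OF \<Delta> tensor_map_hom[OF B B BB B \<Delta> poisson_hom_id]]
            tensor_assoc_hom[OF B B B]])
      show "tensor_map F B ?BB id \<Delta> \<circ> \<Delta> \<in> poisson_hom F B (tensor_poisson F B ?BB)"
        by (rule poisson_hom_comp[OF \<Delta> tensor_map_hom[OF B B B BB poisson_hom_id \<Delta>]])
      fix p assume p: "p \<in> carrier P"
      have "tensor_map F U (tensor_space F B B) id \<Delta> (\<phi> u)
          = tensor_assoc F U B B (tensor_map F (tensor_space F U B) B \<phi> id (\<phi> u))"
        if "u \<in> carrier U" for u
        using coaction(6)[OF poisson_homD(3)[OF f that]] by (simp add: \<phi>_def)
      then show "tensor_map F U (tensor_poisson F B ?BB) id
            (tensor_assoc F B B B \<circ> (tensor_map F ?BB B \<Delta> id \<circ> \<Delta>)) (\<psi> p)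
          = tensor_map F U (tensor_poisson F B ?BB) id (tensor_map F B ?BB id \<Delta> \<circ> \<Delta>) (\<psi> p)"
        unfolding tensor_map_poisson tensor_space_poisson
        by (rule coaction_coassociative[OF coaction(1-4) coaction(5,6)[OF p]])
    qed
    then show "tensor_assoc F B B B (tensor_map F (tensor_space F B B) B \<Delta> id (\<Delta> b))
        = tensor_map F B (tensor_space F B B) id \<Delta> (\<Delta> b)"
      by (simp add: tensor_map_poisson)
  qed
  have counit: "\<exists>\<epsilon> \<in> poisson_hom F B ?I. poisson_bialgebra F B \<Delta> \<epsilon>"
    if g: "g \<in> poisson_hom F P U" and fg: "\<forall>p\<in>carrier P. \<psi> p = \<psi> ((f \<circ> g) p)"
      and gf: "\<forall>p\<in>carrier P. \<psi> p = tensor_map F U B (g \<circ> f) id (\<psi> p)" for g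
  proof -
    interpret F: field F by (rule assms(1))
    interpret BM: module F B by (rule mB)
    \<comment> \<open>The counit \<open>\<epsilon>\<^sub>g\<close> is the morphism classifying \<open>g\<close>, seen as a map into \<open>U \<otimes> F \<cong> U\<close>.\<close>
    have "(\<lambda>u. pure_tensor F U ?I u \<one>\<^bsub>?I\<^esub>) \<circ> g \<in> poisson_hom F P (tensor_poisson F U ?I)"
      by (rule poisson_hom_comp[OF g tensor_inl_hom[OF U I]])
    then obtain \<epsilon> where \<epsilon>: "\<epsilon> \<in> poisson_hom F B ?I"
      and \<epsilon>_\<psi>: "\<And>p. p \<in> carrier P \<Longrightarrow> tensor_map F U ?I id \<epsilon> (\<psi> p) = pure_tensor F U ?I (g p) \<one>\<^bsub>F\<^esub>"
      using universal_coacting_exists[OF U univ I eI] by force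
    have one: "\<one>\<^bsub>F\<^esub> \<in> carrier ?I" by simp
    let ?l = "tensor_lift B (\<lambda>c x. c \<odot>\<^bsub>B\<^esub> x)" and ?r = "tensor_lift B (\<lambda>x c. c \<odot>\<^bsub>B\<^esub> x)"
    note l = left_unitor_hom[OF B] and r = right_unitor_hom[OF B]
    have l_lin: "linear_on F (tensor_space F ?I B) B ?l" and r_lin: "linear_on F (tensor_space F B ?I) B ?r"
      using poisson_homD(1)[OF l(1)] poisson_homD(1)[OF r(1)] by (simp_all only: linear_on_poisson)
    have l_one: "?l (pure_tensor F ?I B \<one>\<^bsub>F\<^esub> b) = b" and r_one: "?r (pure_tensor F B ?I b \<one>\<^bsub>F\<^esub>) = b"
      if "b \<in> carrier B" for b
      using that by (simp_all add: l(2) r(2))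
    have left: "(?l \<circ> (tensor_map F ?I B \<epsilon> id \<circ> \<Delta>)) b = id b" if b: "b \<in> carrier B" for b
    proof (rule universal_coacting_unique[OF U univ B eB _ poisson_hom_id _ b])
      show "?l \<circ> (tensor_map F ?I B \<epsilon> id \<circ> \<Delta>) \<in> poisson_hom F B B"
        by (rule poisson_hom_comp[OF poisson_hom_comp[OF \<Delta> tensor_map_hom[OF B B I B \<epsilon> poisson_hom_id]] l(1)])
      fix p assume p: "p \<in> carrier P"
      have "tensor_map F U B id (?l \<circ> (tensor_map F ?I B \<epsilon> id \<circ> \<Delta>)) (\<psi> p) = tensor_map F U B (g \<circ> f) id (\<psi> p)"
        by (rule coaction_counit_left[OF coaction(1-4) coaction(5,6)[OF p] mI poisson_homD(1)[OF \<epsilon>] one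
              l_lin l_one poisson_homD(1)[OF poisson_hom_comp[OF f g]]])
          (simp_all add: \<phi>_def \<epsilon>_\<psi> poisson_homD(3)[OF f])
      then show "tensor_map F U B id (?l \<circ> (tensor_map F ?I B \<epsilon> id \<circ> \<Delta>)) (\<psi> p) = tensor_map F U B id id (\<psi> p)"
        using bspec[OF gf p] tensor_map_id[OF mU mB \<psi>_in[OF p]] by simp
    qed
    have right: "(?r \<circ> (tensor_map F B ?I id \<epsilon> \<circ> \<Delta>)) b = id b" if b: "b \<in> carrier B" for b
    proof (rule universal_coacting_unique[OF U univ B eB _ poisson_hom_id _ b])
      show "?r \<circ> (tensor_map F B ?I id \<epsilon> \<circ> \<Delta>) \<in> poisson_hom F B B"
        by (rule poisson_hom_comp[OF poisson_hom_comp[OF \<Delta> tensor_map_hom[OF B B B I poisson_hom_id \<epsilon>]] r(1)])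
      fix p assume p: "p \<in> carrier P"
      have "tensor_map F U B id (?r \<circ> (tensor_map F B ?I id \<epsilon> \<circ> \<Delta>)) (\<psi> p) = \<phi> (g p)"
        by (rule coaction_counit_right[OF coaction(1-4) coaction(5,6)[OF p] mI poisson_homD(1)[OF \<epsilon>] one
              r_lin r_one poisson_homD(3)[OF g p] \<epsilon>_\<psi>[OF p]])
      then show "tensor_map F U B id (?r \<circ> (tensor_map F B ?I id \<epsilon> \<circ> \<Delta>)) (\<psi> p) = tensor_map F U B id id (\<psi> p)"
        using bspec[OF fg p] tensor_map_id[OF mU mB \<psi>_in[OF p]] by (simp add: \<phi>_def)
    qed
    have "counital F B \<Delta> \<epsilon>"
      unfolding counital_def using left right by simp
    then show ?thesis
      using B \<Delta> \<epsilon> coassoc by (intro bexI[OF _ \<epsilon>]) (simp add: poisson_bialgebra_def)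
  qed
  show ?thesis
    by (intro exI[of _ \<Delta>] conjI ballI impI \<Delta> coassoc) (elim conjE, rule counit)
qed

end
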